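(* (A) For $n$ odd, every equiangular hedgehog with $n$ sides of zero perimeter has a unique infinite sequence of iterated $\mathcal P$-evolvents. Generically, the polygons in this sequence expand, tending in their shapes to two discrete hypocycloids of order $\frac{n-1}2$. (B) For $n$ even, every equiangular hedgehog with $n$ sides whose signed side lengths satisfy $\ell_1+\ell_3+\dots+\ell_{n-1}=0=\ell_2+\ell_4+\dots+\ell_n$ has a unique infinite sequence of $\mathcal P$-evolvents. Generically, the polygons in this sequence tend to two discrete hypocycloids of order $\frac n2-1$. Otherwise they shrink to the vertex centroid of the initial hedgehog, tending in shape to discrete hypocycloids of some other order.
   Context: A cooriented line $(\alpha,p)$ is the line $x\cos\alpha+y\sin\alpha=p$ with coorienting normal $(\cos\alpha,\sin\alpha)$; it is oriented by the normal turned counterclockwise by $\pi/2$. A cooriented $n$-gon is a cyclically ordered sequence of cooriented lines $l_j=(\alpha_j,p_j)$ (indices mod $n$) such that $l_j$ and $l_{j+1}$ meet at a single point, the vertex $P_{j+\frac12}$. It is an equiangular hedgehog if $\alpha_{j+1}-\alpha_j\equiv 2\pi/n\pmod{2\pi}$ for all $j$. The signed length $\ell_j$ of the $j$-th side is the distance from $P_{j-\frac12}$ to $P_{j+\frac12}$, taken with the negative sign if the order of these vertices disagrees with the orientation of $l_j$; the perimeter is $\sum_j\ell_j$. The vertex centroid is the arithmetic mean of the vertices. A (smooth) hypocycloid of order $m$ is the envelope of the lines $(\alpha,\ a\cos m\alpha+b\sin m\alpha)$, up to choice of the origin. A discrete hypocycloid of order $m\le n/2$ is an equiangular hedgehog whose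 sides are tangent to a hypocycloid of order $m$; with the origin at the center of the hypocycloid and the $x$-axis along a suitable side normal, its sides are $\left(\frac{2\pi j}n,\ a\cos\frac{2\pi mj}n+b\sin\frac{2\pi mj}n\right)$, $j=1,\dots,n$. The $\mathcal P$-evolute (perpendicular bisector evolute) of a cooriented polygon is the cooriented polygon $(l_1^*,\dots,l_n^* )$, where $l_j^*$ passes through the midpoint of the segment $P_{j-\frac12}P_{j+\frac12}$ and its direction is that of $l_j$ turned counterclockwise by $\pi/2$. A $\mathcal P$-involute of $\mathbf Q$ is a polygon whose $\mathcal P$-evolute is $\mathbf Q$. Adding a constant to all support numbers $p_j$ of a $\mathcal P$-involute of an equiangular hedgehog, or, for $n$ even, adding a multiple of $(-1)^j$ to the $p_j$, again gives a $\mathcal P$-involute. The $\mathcal P$-evolvent is the $\mathcal P$-involute for which these components are absent: $\sum_jp_j=0$ and, for $n$ even, also $\sum_j(-1)^jp_j=0$. Equivalently, it has zero perimeter for $n$ odd, and satisfies $\ell_1+\ell_3+\dots+\ell_{n-1}=0=\ell_2+\ell_4+\dots+\ell_n$ for $n$ even, so that the construction can be iterated.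
   Formalization: In (A) expansion and distinct limits are claimed only for n>3, in (B) distinct limits only for n>4 (else all are points). In the last claim, if orders k and n/2-k are both slowest-decaying, the limit shapes are sums of hypocycloids of these two orders (the single-order claim fails there). *)

theory Defs
  imports "HOL-Analysis.Analysis"
begin

text \<open>
  The Euclidean plane is the type of complex numbers, with \<open>\<bullet>\<close> the real inner product.
  The cooriented line \<open>(\<alpha>, p)\<close> is the pair of its coorienting unit normal \<open>cis \<alpha>\<close> and its support
  number \<open>p\<close>. As \<open>\<alpha>\<close> matters only modulo \<open>2\<pi>\<close>, equality of such pairs is equality
  of cooriented lines. The unit length of the normal is required in \<open>cooriented_polygon\<close> below.
\<close>

type_synonym coline = "complex \<times> real"

abbreviation (input) conormal :: "coline \<Rightarrow> complex" where "conormal \<equiv> fst"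
abbreviation (input) suppnum :: "coline \<Rightarrow> real" where "suppnum \<equiv> snd"

definition coline :: "real \<Rightarrow> real \<Rightarrow> coline"
  where "coline \<alpha> p = (cis \<alpha>, p)"

definition points :: "coline \<Rightarrow> complex set"
  where "points l = {z. z \<bullet> conormal l = suppnum l}"

definition direction :: "coline \<Rightarrow> complex"
  where "direction l = \<i> * conormal l"

text \<open>A cyclic sequence is a function on the integers with period \<open>n\<close>.\<close>

type_synonym polygon = "int \<Rightarrow> coline"

definition cooriented_polygon :: "nat \<Rightarrow> polygon \<Rightarrow> bool" where
  "cooriented_polygon n Q \<longleftrightarrow>
     (\<forall>j. norm (conormal (Q j)) = 1) \<and>
     (\<forall>j. Q (j + int n) = Q j) \<and>
     (\<forall>j. \<exists>!z. z \<in> points (Q j) \<inter> points (Q (j + 1)))"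

text \<open>\<open>vertex Q j\<close> is \<open>P\<close> with index \<open>j + 1/2\<close>; the endpoints of the \<open>j\<close>-th side are
  \<open>vertex Q (j - 1)\<close> and \<open>vertex Q j\<close>.\<close>

definition vertex :: "polygon \<Rightarrow> int \<Rightarrow> complex"
  where "vertex Q j = (THE z. z \<in> points (Q j) \<inter> points (Q (j + 1)))"

definition equiangular_hedgehog :: "nat \<Rightarrow> polygon \<Rightarrow> bool" where
  "equiangular_hedgehog n Q \<longleftrightarrow>
     cooriented_polygon n Q \<and>
     (\<forall>j. conormal (Q (j + 1)) = cis (2 * pi / real n) * conormal (Q j))"

definition side_length :: "polygon \<Rightarrow> int \<Rightarrow> real" where
  "side_length Q j =
     (if (vertex Q j - vertex Q (j - 1)) \<bullet> direction (Q j) < 0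
      then - dist (vertex Q (j - 1)) (vertex Q j)
      else dist (vertex Q (j - 1)) (vertex Q j))"

definition perimeter :: "nat \<Rightarrow> polygon \<Rightarrow> real"
  where "perimeter n Q = (\<Sum>j=1..n. side_length Q (int j))"

definition vertex_centroid :: "nat \<Rightarrow> polygon \<Rightarrow> complex"
  where "vertex_centroid n Q = (\<Sum>j=1..n. vertex Q (int j)) /\<^sub>R real n"

text \<open>Turning a cooriented line by \<open>\<pi>/2\<close> turns its normal by \<open>\<pi>/2\<close>, i.e. to its former direction.\<close>

definition P_evolute :: "polygon \<Rightarrow> polygon" where
  "P_evolute Q j =
     (\<i> * conormal (Q j), midpoint (vertex Q (j - 1)) (vertex Q j) \<bullet> (\<i> * conormal (Q j)))"

definition P_involute :: "nat \<Rightarrow> polygon \<Rightarrow> polygon \<Rightarrow> bool"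
  where "P_involute n Q R \<longleftrightarrow> cooriented_polygon n R \<and> P_evolute R = Q"

definition P_evolvent :: "nat \<Rightarrow> polygon \<Rightarrow> polygon \<Rightarrow> bool" where
  "P_evolvent n Q R \<longleftrightarrow>
     P_involute n Q R \<and>
     (\<Sum>j=1..n. suppnum (R (int j))) = 0 \<and>
     (even n \<longrightarrow> (\<Sum>j=1..n. (-1) ^ j * suppnum (R (int j))) = 0)"

definition iterated_evolvents :: "nat \<Rightarrow> polygon \<Rightarrow> (nat \<Rightarrow> polygon) \<Rightarrow> bool" where
  "iterated_evolvents n Q S \<longleftrightarrow> S 0 = Q \<and> (\<forall>k. P_evolvent n (S k) (S (Suc k)))"

text \<open>
  \<open>hypocycloid_tangent c m a b\<close> is the family of cooriented lines enveloping a hypocycloid of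
  order \<open>m\<close> with center \<open>c\<close>: relative to \<open>c\<close>, the support number at angle \<open>\<alpha>\<close> is
  \<open>a cos m\<alpha> + b sin m\<alpha>\<close>.
\<close>

definition hypocycloid_tangent :: "complex \<Rightarrow> nat \<Rightarrow> real \<Rightarrow> real \<Rightarrow> real \<Rightarrow> coline" where
  "hypocycloid_tangent c m a b \<alpha> =
     coline \<alpha> (a * cos (real m * \<alpha>) + b * sin (real m * \<alpha>) + c \<bullet> cis \<alpha>)"

text \<open>
  Since \<open>m\<close> is an integer, rotating the \<open>x\<close>-axis to a side normal only changes \<open>a\<close> and \<open>b\<close>, which
  gives the sides \<open>(2\<pi>j/n, a cos (2\<pi>mj/n) + b sin (2\<pi>mj/n))\<close>. The zero amplitude is excluded;
  a hypocycloid of order \<open>1\<close> is nevertheless a point (all its tangents pass through \<open>c + (a, b)\<close>).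
\<close>

definition discrete_hypocycloid :: "nat \<Rightarrow> nat \<Rightarrow> polygon \<Rightarrow> bool" where
  "discrete_hypocycloid n m L \<longleftrightarrow>
     equiangular_hedgehog n L \<and> 1 \<le> m \<and> 2 * m \<le> n \<and>
     (\<exists>c a b. (a, b) \<noteq> (0, 0) \<and> (\<forall>j. \<exists>\<alpha>. L j = hypocycloid_tangent c m a b \<alpha>))"

text \<open>Sum of two hedgehogs with the same normals: support numbers are added.\<close>

definition hypocycloid_sum :: "nat \<Rightarrow> nat \<Rightarrow> nat \<Rightarrow> polygon \<Rightarrow> bool" where
  "hypocycloid_sum n m m' L \<longleftrightarrow>
     (\<exists>H H'. discrete_hypocycloid n m H \<and> discrete_hypocycloid n m' H' \<and>
        (\<forall>j. conormal (L j) = conormal (H j) \<and> conormal (L j) = conormal (H' j) \<and>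
             suppnum (L j) = suppnum (H j) + suppnum (H' j)))"

definition point_polygon :: "polygon \<Rightarrow> bool"
  where "point_polygon Q \<longleftrightarrow> (\<exists>z. \<forall>j. vertex Q j = z)"

definition homothetic :: "polygon \<Rightarrow> polygon \<Rightarrow> bool" where
  "homothetic Q R \<longleftrightarrow> (\<exists>s c. s > 0 \<and> (\<forall>j. vertex R j = s *\<^sub>R vertex Q j + c))"

text \<open>
  Convergence is convergence of corresponding vertices: two consecutive even (or odd) terms of a
  sequence of evolvents have opposite normals, so the coorientations do not converge.
\<close>

definition tends_to :: "(nat \<Rightarrow> polygon) \<Rightarrow> polygon \<Rightarrow> bool"
  where "tends_to S L \<longleftrightarrow> (\<forall>j. (\<lambda>k. vertex (S k) j) \<longlonglongrightarrow> vertex L j)"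

text \<open>
  Convergence in shape: suitable positive homotheties (no rotation is needed) make the polygons
  converge. The last condition excludes the trivial limit obtained by scaling everything
  down to a point.
\<close>

definition tends_in_shape_to :: "(nat \<Rightarrow> polygon) \<Rightarrow> polygon \<Rightarrow> bool" where
  "tends_in_shape_to S L \<longleftrightarrow>
     (\<exists>s c. (\<forall>k. s k > 0) \<and>
        (\<forall>j. (\<lambda>k. s k *\<^sub>R (vertex (S k) j - c k)) \<longlonglongrightarrow> vertex L j)) \<and>
     (point_polygon L \<longrightarrow> (\<forall>\<^sub>F k in sequentially. point_polygon (S k)))"

definition expands :: "(nat \<Rightarrow> polygon) \<Rightarrow> bool"
  where "expands S \<longleftrightarrow> filterlim (\<lambda>k. diameter (range (vertex (S k)))) at_top sequentially"

definition shrinks_to :: "(nat \<Rightarrow> polygon) \<Rightarrow> complex \<Rightarrow> bool"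
  where "shrinks_to S z \<longleftrightarrow> (\<forall>j. (\<lambda>k. vertex (S k) j) \<longlonglongrightarrow> z)"

definition zero_perimeter_hedgehogs :: "nat \<Rightarrow> polygon set" where
  "zero_perimeter_hedgehogs n = {Q. equiangular_hedgehog n Q \<and> perimeter n Q = 0}"

definition balanced_hedgehogs :: "nat \<Rightarrow> polygon set" where
  "balanced_hedgehogs n =
     {Q. equiangular_hedgehog n Q \<and>
         (\<Sum>j | j \<in> {1..n} \<and> odd j. side_length Q (int j)) = 0 \<and>
         (\<Sum>j | j \<in> {1..n} \<and> even j. side_length Q (int j)) = 0}"

text \<open>
  Polygons carry the product topology of \<open>int \<Rightarrow> complex \<times> real\<close>; on \<open>n\<close>-periodic sequences
  this is the usual topology of the \<open>n\<close>-fold power of \<open>complex \<times> real\<close>.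
\<close>

definition generic_in :: "polygon set \<Rightarrow> polygon set \<Rightarrow> bool" where
  "generic_in X G \<longleftrightarrow> openin (top_of_set X) G \<and> X \<subseteq> closure G"

text \<open>
  For \<open>n\<close> even, one evolvent step divides the harmonic of order \<open>k\<close> of the support numbers by
  \<open>sin (2\<pi>k/n) / sin (2\<pi>/n)\<close> (up to a phase), so the orders \<open>k\<close> and \<open>n/2 - k\<close> decay at exactly
  the same rate. A hedgehog is resonant if its slowest decaying orders (disregarding order \<open>1\<close>,
  a translation, and order \<open>n/2 - 1\<close>) are two distinct orders \<open>k\<close> and \<open>n/2 - k\<close>. In that
  case the limit shape mixes both orders for ever.
\<close>

definition harmonic :: "nat \<Rightarrow> nat \<Rightarrow> polygon \<Rightarrow> complex" where
  "harmonic n k Q =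
     (\<Sum>j=1..n. of_real (suppnum (Q (int j))) * cis (- (2 * pi * real k * real j / real n)))"

definition resonant :: "nat \<Rightarrow> polygon \<Rightarrow> bool" where
  "resonant n Q \<longleftrightarrow>
     (\<exists>k. 2 \<le> k \<and> 4 * k < n \<and> harmonic n k Q \<noteq> 0 \<and> harmonic n (n div 2 - k) Q \<noteq> 0 \<and>
        (\<forall>i. 2 \<le> i \<and> i < k \<longrightarrow> harmonic n i Q = 0 \<and> harmonic n (n div 2 - i) Q = 0))"

end

theory Submission
  imports Defs
begin

text \<open>
  Let \<open>w = cis (2\<pi>/n)\<close> and let the \<open>j\<close>-th side have normal \<open>u w\<^sup>j\<close> and support number
  \<open>p\<^sub>j\<close>. The \<open>P\<close>-evolute has support numbers \<open>(p\<^bsub>j+1\<^esub> - p\<^bsub>j-1\<^esub>) / (2 sin (2\<pi>/n))\<close> and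
  normals multiplied by \<open>\<i>\<close>. Hence the evolvent multiplies the \<open>k\<close>-th harmonic of \<open>p\<close> by
  \<open>-\<i> sin (2\<pi>/n) / sin (2\<pi>k/n)\<close> and the normals by \<open>-\<i>\<close>. The vertices
  \<open>\<i> u w\<^sup>j (p\<^bsub>j+1\<^esub> - w p\<^sub>j) / sin (2\<pi>/n)\<close> depend linearly on normals times support numbers, so two
  evolvent steps multiply the contribution of the \<open>k\<close>-th harmonic to the vertices by the positive
  number \<open>(sin (2\<pi>/n) / sin (2\<pi>k/n))\<^sup>2\<close>. The harmonics with the largest such factor dominate. Order \<open>1\<close>
  is a translation to the vertex centroid. The limits of the even and of the odd steps are not
  homothetic, because their corresponding sides are perpendicular.
\<close>

subsection \<open>Roots of unity and the discrete Fourier transform\<close>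

text \<open>The comparison of rates is a matter of integers: sin (2 pi k / n) = cos (pi |n - 4k| /
  (2n)), so the two-step factor of order \<open>k\<close> increases with the distance of
  \<open>k\<close> from \<open>n/4\<close>. For odd \<open>n > 3\<close> the order
  \<open>(n - 1)/2\<close> lies farther from \<open>n/4\<close> than order 1, whose factor is 1; its
  own factor therefore exceeds 1 and the polygons expand. For even \<open>n > 4\<close> the orders 1
  and \<open>n/2 - 1\<close> are mirror images in \<open>n/4\<close>, so both have factor 1 and all
  others die out. The same mirror symmetry pairs \<open>k\<close> with \<open>n/2 - k\<close>, which
  is why the dominant part of a degenerate hedgehog can consist of two harmonics. The conditions on
  the side lengths say that the harmonics of order 0 and, for even \<open>n\<close>, of order
  \<open>n/2\<close> vanish. These are the orders with sin (2 pi k / n) = 0, which the evolute map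
  annihilates and which no evolvent step could recover. Limits are computed along even steps only:
  the odd steps are the even steps of the sequence that starts at the first evolvent.\<close>

definition rou :: "nat \<Rightarrow> int \<Rightarrow> complex"
  where "rou n a = cis (2 * pi * real_of_int a / real n)"

lemma dvd_imp_zero: "int n dvd a \<Longrightarrow> \<bar>a\<bar> < int n \<Longrightarrow> a = 0"
  using dvd_imp_le_int[of a "int n"] by linarith

lemma rou_0 [simp]: "rou n 0 = 1"
  by (simp add: rou_def)

lemma rou_add: "rou n (a + b) = rou n a * rou n b"
  by (simp add: rou_def cis_mult add_divide_distrib ring_distribs)

lemma rou_minus: "rou n (- a) = cnj (rou n a)"
  by (simp add: rou_def cis_cnj)

lemma norm_rou [simp]: "norm (rou n a) = 1"
  by (simp add: rou_def)

lemma rou_mult_cnj [simp]: "rou n a * cnj (rou n a) = 1" "cnj (rou n a) * rou n a = 1"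
  by (simp_all add: complex_norm_square[symmetric] mult.commute)

lemma rou_nonzero [simp]: "rou n a \<noteq> 0"
  by (simp add: rou_def)

lemma rou_eq_1_iff:
  assumes "n > 0"
  shows "rou n a = 1 \<longleftrightarrow> int n dvd a"
proof
  assume "rou n a = 1"
  then have "cos (2 * pi * real_of_int a / real n) = 1"
    by (metis rou_def cis.sel(1) one_complex.sel(1))
  then obtain x :: int where "2 * pi * real_of_int a / real n = real_of_int x * 2 * pi"
    using cos_one_2pi_int by blast
  then have "real_of_int a = real_of_int (int n * x)"
    using assms by (simp add: field_simps)
  then have "a = int n * x"
    by (metis of_int_eq_iff)
  then show "int n dvd a" by simp
next
  assume "int n dvd a"
  then obtain x where "a = int n * x" by blast
  then have "2 * pi * real_of_int a / real n = 2 * pi * of_int x"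
    using assms by simp
  then show "rou n a = 1"
    unfolding rou_def by (metis cis_multiple_2pi Ints_of_int)
qed

lemma rou_periodic: "n > 0 \<Longrightarrow> rou n (a + int n * b) = rou n a"
  by (simp add: rou_add rou_eq_1_iff)

lemma rou_eqI: "n > 0 \<Longrightarrow> int n dvd a - b \<Longrightarrow> rou n a = rou n b"
  using rou_add[of n b "a - b"] by (simp add: rou_eq_1_iff)

text \<open>The two sums telescope to the difference \<open>f (n + 1) - f 1\<close>, which
  periodicity kills.\<close>

lemma sum_periodic_shift:
  fixes f :: "int \<Rightarrow> 'a::ab_group_add"
  assumes "\<And>j. f (j + int n) = f j"
  shows "(\<Sum>j=1..n. f (int j + 1)) = (\<Sum>j=1..n. f (int j))"
proof -
  have "(\<Sum>j=1..m. f (int j + 1)) = (\<Sum>j=1..m. f (int j)) + f (int m + 1) - f 1" for m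
    by (induction m) (auto simp: algebra_simps)
  moreover have "f (int n + 1) = f 1"
    using assms[of 1] by (simp add: add.commute)
  ultimately show ?thesis by simp
qed

text \<open>Shifting the index multiplies the sum by \<open>rou n a\<close>, so the sum vanishes
  unless this root of unity is 1.\<close>

lemma sum_rou:
  assumes "n > 0"
  shows "(\<Sum>j=1..n. rou n (a * int j)) = (if int n dvd a then of_nat n else 0)"
proof (cases "int n dvd a")
  case True
  then have "rou n (a * int j) = 1" for j
    using assms by (simp add: rou_eq_1_iff)
  then show ?thesis using True by simp
next
  case False
  have "rou n (a * (j + int n)) = rou n (a * j)" for j
    using rou_periodic[OF assms, of "a * j" a] by (simp add: algebra_simps)
  from sum_periodic_shift[where f = "\<lambda>j. rou n (a * j)", OF this]
  have "rou n a * (\<Sum>j=1..n. rou n (a * int j)) = (\<Sum>j=1..n. rou n (a * int j))"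
    by (simp add: ring_distribs rou_add sum_distrib_left mult.commute)
  moreover have "rou n a \<noteq> 1"
    using False assms by (simp add: rou_eq_1_iff)
  ultimately show ?thesis using False by simp
qed

text \<open>Unlike \<open>harmonic\<close>, it takes an arbitrary real sequence, so it also applies
  to side lengths, shifted sequences and waves.\<close>

definition dft :: "nat \<Rightarrow> nat \<Rightarrow> (int \<Rightarrow> real) \<Rightarrow> complex"
  where "dft n k p = (\<Sum>j=1..n. of_real (p (int j)) * rou n (- (int k * int j)))"

lemma harmonic_eq_dft: "harmonic n k Q = dft n k (\<lambda>j. suppnum (Q j))"
  by (simp add: harmonic_def dft_def rou_def mult_ac)

lemma dft_add: "dft n k (\<lambda>j. p j + q j) = dft n k p + dft n k q"
  by (simp add: dft_def sum.distrib ring_distribs)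

lemma dft_diff: "dft n k (\<lambda>j. p j - q j) = dft n k p - dft n k q"
  by (simp add: dft_def sum_subtractf ring_distribs)

lemma dft_scale: "dft n k (\<lambda>j. c * p j) = of_real c * dft n k p"
  by (simp add: dft_def sum_distrib_left mult_ac)

lemma dft_sum: "dft n k (\<lambda>j. \<Sum>i\<in>I. p i j) = (\<Sum>i\<in>I. dft n k (p i))"
  by (induction I rule: infinite_finite_induct) (simp_all add: dft_add, simp_all add: dft_def)

lemma dft_shift:
  assumes "n > 0" and "\<And>j. p (j + int n) = p j"
  shows "dft n k (\<lambda>j. p (j + 1)) = rou n (int k) * dft n k p"
proof -
  have "rou n (- (int k * (j + int n))) = rou n (- (int k * j))" for j
    using rou_periodic[OF assms(1), of "- (int k * j)" "- int k"] by (simp add: algebra_simps)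
  then have "(\<Sum>j=1..n. of_real (p (int j + 1)) * rou n (- (int k * (int j + 1)))) = dft n k p"
    unfolding dft_def using assms(2)
    by (intro sum_periodic_shift[where f = "\<lambda>j. of_real (p j) * rou n (- (int k * j))"]) simp
  moreover have "rou n (int k) * (of_real (p (int j + 1)) * rou n (- (int k * (int j + 1))))
      = of_real (p (int j + 1)) * rou n (- (int k * int j))" for j :: nat
    using rou_add[of n "int k" "- (int k * (int j + 1))"] by (simp add: algebra_simps)
  ultimately show ?thesis
    by (metis (no_types, lifting) dft_def sum.cong sum_distrib_left)
qed

lemma dft_shift_back:
  assumes "n > 0" and "\<And>j. p (j + int n) = p j"
  shows "dft n k (\<lambda>j. p (j - 1)) = rou n (- int k) * dft n k p"
proof -
  have "p (j - 1 + int n) = p (j - 1)" for j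
    using assms(2)[of "j - 1"] .
  then have "dft n k p = rou n (int k) * dft n k (\<lambda>j. p (j - 1))"
    using dft_shift[of n "\<lambda>j. p (j - 1)" k] assms(1) by (simp add: algebra_simps)
  then show ?thesis by (simp add: rou_minus flip: mult.assoc)
qed

text \<open>
  A real periodic sequence has conjugate harmonics of orders \<open>k\<close> and \<open>n - k\<close>, and those of order \<open>0\<close>
  and \<open>n/2\<close> vanish for the hedgehogs considered here, so the following orders suffice.
\<close>

definition orders :: "nat \<Rightarrow> nat set"
  where "orders n = {k. 1 \<le> k \<and> 2 * k < n}"

lemma finite_orders [simp]: "finite (orders n)"
  by (rule finite_subset[of _ "{..n}"]) (auto simp: orders_def)

lemma periodic_int:
  fixes f :: "int \<Rightarrow> 'a"
  assumes "\<And>j. f (j + int n) = f j"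
  shows "f (a + int n * b) = f a"
proof -
  have pm: "f (a + int n * int m) = f a" for m a
  proof (induction m)
    case (Suc m)
    then show ?case using assms[of "a + int n * int m"] by (simp add: algebra_simps)
  qed simp
  show ?thesis
    using pm[of a "nat b"] pm[of "a + int n * b" "nat (- b)"]
    by (cases "b \<ge> 0") (simp_all add: algebra_simps)
qed

text \<open>After exchanging the sums, the inner geometric sum over \<open>k\<close> singles out the
  one index in \<open>{1..n}\<close> congruent to \<open>j\<close>.\<close>

lemma dft_inverse:
  assumes "n > 0" and per: "\<And>j. p (j + int n) = p j"
  shows "(\<Sum>k<n. dft n k p * rou n (int k * j)) = of_nat n * of_real (p j)"
proof -
  obtain i where i: "i \<in> {1..n}" "int n dvd j - int i"
  proof
    \<comment> \<open>Representatives run through \<open>{1..n}\<close> as in \<open>dft\<close>, so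
      the residue 0 is represented by \<open>n\<close>.\<close>
    define i where "i = (if int n dvd j then n else nat (j mod int n))"
    show "i \<in> {1..n}"
      using assms(1) pos_mod_bound[of "int n" j] pos_mod_sign[of "int n" j]
      by (auto simp: i_def dvd_eq_mod_eq_0 le_nat_iff nat_le_iff simp del: pos_mod_bound pos_mod_sign)
    show "int n dvd j - int i"
      using assms(1) by (auto simp: i_def dvd_minus_mod)
  qed
  have "p (a + int n * b) = p a" for a b
    using periodic_int[where f = p, OF per] .
  then have pj: "p j = p (int i)"
    using i(2) by (metis add.commute diff_add_cancel dvdE)
  have uniq: "int n dvd j - int l \<longleftrightarrow> l = i" if "l \<in> {1..n}" for l
  proof
    assume "int n dvd j - int l"
    then have "int n dvd int i - int l"
      using dvd_diff[OF _ i(2)] by fastforce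
    moreover have "\<bar>int i - int l\<bar> < int n" using that i(1) by auto
    ultimately show "l = i" using dvd_imp_zero[of n "int i - int l"] by simp
  qed (use i in simp)
  \<comment> \<open>The sum here runs over \<open>0..n-1\<close>, that of \<open>sum_rou\<close>
    over \<open>1..n\<close>; the end terms agree because \<open>rou n (a * n) = 1\<close>.\<close>
  have geo: "(\<Sum>k<n. rou n (a * int k)) = (if int n dvd a then of_nat n else 0)" for a
  proof -
    have "(\<Sum>k<n. rou n (a * int k)) + rou n (a * int n) = 1 + (\<Sum>k<n. rou n (a * int (Suc k)))"
      using sum.lessThan_Suc_shift[of "\<lambda>k. rou n (a * int k)" n] by simp
    then have "(\<Sum>k<n. rou n (a * int k)) = (\<Sum>k<n. rou n (a * int (Suc k))) - rou n (a * int n) + 1"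
      by algebra
    also have "(\<Sum>k<n. rou n (a * int (Suc k))) = (\<Sum>k=1..n. rou n (a * int k))"
      by (rule sum.reindex_bij_witness[of _ "\<lambda>k. k - 1" Suc]) auto
    finally show ?thesis
      using assms(1) by (simp only: sum_rou rou_eq_1_iff dvd_triv_right) (simp add: rou_eq_1_iff)
  qed
  have "(\<Sum>k<n. dft n k p * rou n (int k * j))
      = (\<Sum>k<n. \<Sum>l=1..n. of_real (p (int l)) * rou n ((j - int l) * int k))"
  proof -
    have "rou n (- (int k * int l)) * rou n (int k * j) = rou n ((j - int l) * int k)" for k l :: nat
      by (simp add: algebra_simps flip: rou_add)
    then show ?thesis by (simp add: dft_def sum_distrib_right mult.assoc)
  qed
  also have "\<dots> = (\<Sum>l=1..n. of_real (p (int l)) * (\<Sum>k<n. rou n ((j - int l) * int k)))"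
    by (subst sum.swap) (simp add: sum_distrib_left)
  also have "\<dots> = (\<Sum>l=1..n. if l = i then of_nat n * of_real (p (int i)) else 0)"
    by (rule sum.cong) (use uniq in \<open>auto simp: geo\<close>)
  also have "\<dots> = of_nat n * of_real (p j)"
    using i(1) by (simp add: pj)
  finally show ?thesis .
qed

lemma dft_cnj:
  assumes "n > 0" and "k \<le> n"
  shows "dft n (n - k) p = cnj (dft n k p)"
proof -
  have "rou n (- (int (n - k) * int j)) = cnj (rou n (- (int k * int j)))" for j :: nat
    unfolding rou_minus[symmetric]
    by (rule rou_eqI) (use assms in \<open>auto simp: of_nat_diff algebra_simps\<close>)
  then show ?thesis by (simp add: dft_def)
qed

text \<open>The complex amplitude \<open>A\<close> stores both coefficients of a real harmonic: the
  cosine part in \<open>Re A\<close>, the sine part in \<open>- Im A\<close>.\<close>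

definition wave :: "nat \<Rightarrow> nat \<Rightarrow> complex \<Rightarrow> int \<Rightarrow> real"
  where "wave n k A j = Re (A * rou n (int k * j))"

lemma wave_periodic: "n > 0 \<Longrightarrow> wave n k A (j + int n) = wave n k A j"
  using rou_periodic[of n "int k * j" "int k"] by (simp add: wave_def algebra_simps)

text \<open>A real wave of order \<open>m\<close> consists of the frequencies \<open>m\<close> and
  \<open>-m\<close>. The bounds \<open>2 * m < n\<close> and \<open>2 * k \<le> n\<close> keep
  \<open>m - k\<close> and \<open>m + k\<close> below \<open>n\<close> in absolute value, so modulo
  \<open>n\<close> only the coincidence \<open>k = m\<close> is possible.\<close>

lemma dft_wave:
  assumes "m \<in> orders n" and "2 * k \<le> n"
  shows "dft n k (wave n m A) = (if k = m then of_nat n / 2 * A else 0)"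
proof -
  have n: "n > 0" using assms by (auto simp: orders_def)
  have d1: "int n dvd int m - int k \<longleftrightarrow> k = m"
  proof
    assume "int n dvd int m - int k"
    moreover have "\<bar>int m - int k\<bar> < int n" using assms by (auto simp: orders_def)
    ultimately show "k = m" using dvd_imp_zero[of n "int m - int k"] by simp
  qed simp
  have d2: "\<not> int n dvd - int m - int k"
  proof
    assume "int n dvd - int m - int k"
    moreover have "\<bar>- int m - int k\<bar> < int n" using assms by (auto simp: orders_def)
    ultimately show False
      using dvd_imp_zero[of n "- int m - int k"] assms(1) by (simp add: orders_def)
  qed
  have "of_real (wave n m A j) * rou n (- (int k * j))
     = A / 2 * rou n ((int m - int k) * j) + cnj A / 2 * rou n ((- int m - int k) * j)" for j
  proof -
    have w: "complex_of_real (wave n m A j) = (A * rou n (int m * j) + cnj A * rou n (- (int m * j))) / 2"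
      by (simp add: wave_def rou_minus complex_eq_iff)
    have r: "rou n ((int m - int k) * j) = rou n (int m * j) * rou n (- (int k * j))"
      "rou n ((- int m - int k) * j) = rou n (- (int m * j)) * rou n (- (int k * j))"
      by (simp_all add: left_diff_distrib flip: rou_add)
    show ?thesis unfolding w r by (simp add: field_simps)
  qed
  then have "dft n k (wave n m A) =
     A / 2 * (\<Sum>j=1..n. rou n ((int m - int k) * int j))
     + cnj A / 2 * (\<Sum>j=1..n. rou n ((- int m - int k) * int j))"
    by (simp add: dft_def sum.distrib sum_distrib_left)
  then show ?thesis
    unfolding sum_rou[OF n] d1 using d2 by (auto split: if_splits)
qed

text \<open>In the inversion formula the terms of orders \<open>k\<close> and \<open>n - k\<close>
  are conjugate and have equal real parts; pairing them produces the amplitude factor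
  \<open>2 / n\<close>.\<close>

lemma wave_expansion:
  assumes "n > 0" and "\<And>j. p (j + int n) = p j"
    and "dft n 0 p = 0" and "even n \<Longrightarrow> dft n (n div 2) p = 0"
  shows "p j = (\<Sum>k\<in>orders n. wave n k (2 / of_nat n * dft n k p) j)"
proof -
  define f where "f k = Re (dft n k p * rou n (int k * j))" for k
  have fsym: "f (n - k) = f k" if "k \<in> orders n" for k
  proof -
    have "rou n (int (n - k) * j) = rou n (- (int k * j))"
      by (rule rou_eqI) (use that assms(1) in \<open>auto simp: orders_def of_nat_diff algebra_simps\<close>)
    then show ?thesis
      using that assms(1) dft_cnj[of n k p] by (simp add: f_def rou_minus orders_def)
  qed
  have "real n * p j = Re (\<Sum>k<n. dft n k p * rou n (int k * j))"
    using dft_inverse[OF assms(1), of p, OF assms(2)] by simp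
  also have "\<dots> = (\<Sum>k<n. f k)"
    by (simp add: f_def)
  \<comment> \<open>Outside the two mirrored halves only the orders 0 and \<open>n/2\<close> remain,
    and these vanish by assumption.\<close>
  also have "\<dots> = sum f (orders n \<union> (\<lambda>k. n - k) ` orders n)"
  proof (rule sum.mono_neutral_right)
    show "orders n \<union> (\<lambda>k. n - k) ` orders n \<subseteq> {..<n}"
      by (auto simp: orders_def)
    show "\<forall>k\<in>{..<n} - (orders n \<union> (\<lambda>k. n - k) ` orders n). f k = 0"
    proof
      fix k assume k: "k \<in> {..<n} - (orders n \<union> (\<lambda>k. n - k) ` orders n)"
      then have "n - k \<notin> orders n"
        by (metis DiffD1 DiffD2 UnI2 diff_diff_cancel image_eqI lessThan_iff less_imp_le)
      with k have "k = 0 \<or> 2 * k = n" by (auto simp: orders_def)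
      then show "f k = 0" using assms(3,4) by (auto simp: f_def)
    qed
  qed simp
  also have "\<dots> = sum f (orders n) + sum f ((\<lambda>k. n - k) ` orders n)"
    by (rule sum.union_disjoint) (auto, auto simp: orders_def)
  also have "sum f ((\<lambda>k. n - k) ` orders n) = sum f (orders n)"
    by (subst sum.reindex) (auto simp: inj_on_def orders_def fsym intro!: sum.cong)
  finally have "p j = (\<Sum>k\<in>orders n. 2 / real n * f k)"
    using assms(1) by (simp add: field_simps flip: sum_distrib_left sum_distrib_right sum_divide_distrib)
  also have "\<dots> = (\<Sum>k\<in>orders n. wave n k (2 / of_nat n * dft n k p) j)"
  proof (rule sum.cong[OF refl])
    fix k
    have "2 / complex_of_nat n * dft n k p * rou n (int k * j)
       = of_real (2 / real n) * (dft n k p * rou n (int k * j))" by simp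
    then show "2 / real n * f k = wave n k (2 / of_nat n * dft n k p) j"
      by (simp only: wave_def f_def) simp
  qed
  finally show ?thesis .
qed

subsection \<open>Vertices and sides of equiangular hedgehogs\<close>

lemma rou_1_eq_cis: "rou n 1 = cis (2 * pi / real n)"
  by (simp add: rou_def)

lemma Im_rou: "Im (rou n (int k)) = sin (2 * pi * real k / real n)"
  by (simp add: rou_def)

lemma Im_rou_pos:
  assumes "k \<in> orders n"
  shows "Im (rou n (int k)) > 0"
  unfolding Im_rou
proof (rule sin_gt_zero)
  show "0 < 2 * pi * real k / real n" using assms by (auto simp: orders_def)
  have "2 * real k < real n" using assms by (simp add: orders_def)
  then show "2 * pi * real k / real n < pi" by (simp add: divide_simps)
qed

lemma one_in_orders: "3 \<le> n \<Longrightarrow> 1 \<in> orders n"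
  by (simp add: orders_def)

lemma Im_rou_1_pos: "3 \<le> n \<Longrightarrow> Im (rou n 1) > 0"
  using Im_rou_pos[OF one_in_orders] by simp

text \<open>Rotating by \<open>cnj a\<close> turns the first normal into 1. Then the first line
  prescribes the real part of \<open>y\<close>, and the second determines its imaginary part since
  \<open>Im w\<close> is nonzero.\<close>

lemma mem_points_Int_iff:
  assumes "norm a = 1" "norm w = 1" "Im w \<noteq> 0"
  shows "z \<in> points (a, p) \<inter> points (a * w, q) \<longleftrightarrow> z = \<i> * a * (of_real q - w * of_real p) / of_real (Im w)"
proof -
  define y where "y = cnj a * z"
  have a: "a * cnj a = 1" using assms(1) by (simp add: complex_norm_square[symmetric])
  have z: "z = a * y" using a by (simp add: y_def flip: mult.assoc)
  have w: "Re w * Re w + Im w * Im w = 1"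
    using assms(2) by (simp add: cmod_def power2_eq_square)
  have 1: "z \<bullet> a = Re y" by (simp add: y_def inner_complex_def algebra_simps)
  have 2: "z \<bullet> (a * w) = Re y * Re w + Im y * Im w"
    by (simp add: y_def inner_complex_def algebra_simps)
  have "z \<in> points (a, p) \<inter> points (a * w, q) \<longleftrightarrow> Re y = p \<and> Re y * Re w + Im y * Im w = q"
    by (simp add: points_def 1 2)
  also have "\<dots> \<longleftrightarrow> y = \<i> * (of_real q - w * of_real p) / of_real (Im w)"
    using assms(3) by (auto simp: complex_eq_iff field_simps)
  also have "\<dots> \<longleftrightarrow> a * y = a * (\<i> * (of_real q - w * of_real p) / of_real (Im w))"
    using assms(1) by (subst mult_cancel_left) auto
  finally show ?thesis by (simp add: z mult_ac)
qed

text \<open>Reduces the geometric notion to data that are easy to construct: one unit normal and a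
  periodic sequence of support numbers. The unique intersection of neighbouring sides amounts to sin
  (2 pi / n) being nonzero, which forces \<open>3 \<le> n\<close>.\<close>

lemma equiangular_hedgehog_iff:
  "equiangular_hedgehog n Q \<longleftrightarrow>
     3 \<le> n \<and> norm (conormal (Q 0)) = 1 \<and> (\<forall>j. conormal (Q j) = conormal (Q 0) * rou n j) \<and>
     (\<forall>j. suppnum (Q (j + int n)) = suppnum (Q j))"
    (is "_ \<longleftrightarrow> ?R")
proof
  assume Q: "equiangular_hedgehog n Q"
  then have nrm: "norm (conormal (Q j)) = 1" and per: "Q (j + int n) = Q j"
    and ex1: "\<exists>!z. z \<in> points (Q j) \<inter> points (Q (j + 1))"
    and step: "conormal (Q (j + 1)) = rou n 1 * conormal (Q j)" for j
    by (auto simp: equiangular_hedgehog_def cooriented_polygon_def rou_1_eq_cis)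
  have "Im (rou n 1) \<noteq> 0"
  proof
    assume Im: "Im (rou n 1) = 0"
    obtain z where z: "z \<in> points (Q 0) \<inter> points (Q (0 + 1))"
      and u: "\<And>y. y \<in> points (Q 0) \<inter> points (Q (0 + 1)) \<Longrightarrow> y = z"
      using ex1[of 0] by blast
    \<comment> \<open>If consecutive sides were parallel, a common point could be moved along them,
      contradicting its uniqueness.\<close>
    have "z + \<i> * conormal (Q 0) \<in> points (Q 0) \<inter> points (Q (0 + 1))"
      using z Im step[of 0] by (auto simp: points_def inner_complex_def algebra_simps)
    then have "conormal (Q 0) = 0" using u by fastforce
    then show False using nrm[of 0] by simp
  qed
  moreover have "Im (rou n 1) = 0" if "n < 3"
  proof -
    \<comment> \<open>For \<open>n = 0\<close> division by zero yields the angle 0, so this case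
      behaves like \<open>n = 1\<close>.\<close>
    from that consider "n = 0" | "n = 1" | "n = 2" by linarith
    then show ?thesis by cases (simp_all add: rou_def)
  qed
  ultimately have "3 \<le> n" by force
  moreover have "conormal (Q j) = conormal (Q 0) * rou n j" for j
  proof (induction j rule: int_induct[where k = 0])
    case (step1 i)
    then show ?case using step[of i] by (simp add: rou_add)
  next
    case (step2 i)
    have "rou n 1 * conormal (Q (i - 1)) = rou n 1 * (conormal (Q 0) * rou n (i - 1))"
      using step[of "i - 1"] step2 rou_add[of n 1 "i - 1"] by simp
    then show ?case by simp
  qed simp
  moreover have "suppnum (Q (j + int n)) = suppnum (Q j)" for j using per by simp
  ultimately show ?R using nrm by blast
next
  assume R: ?R
  then have n: "3 \<le> n" and nrm: "norm (conormal (Q 0)) = 1"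
    and con: "\<And>j. conormal (Q j) = conormal (Q 0) * rou n j"
    and per: "\<And>j. suppnum (Q (j + int n)) = suppnum (Q j)" by blast+
  have step: "conormal (Q (j + 1)) = conormal (Q j) * rou n 1" for j
    using con[of j] con[of "j + 1"] by (simp add: rou_add)
  have unit: "norm (conormal (Q j)) = 1" for j
    using nrm con[of j] by (simp add: norm_mult)
  have "z \<in> points (Q j) \<inter> points (Q (j + 1)) \<longleftrightarrow> z = \<i> * conormal (Q j)
     * (of_real (suppnum (Q (j + 1))) - rou n 1 * of_real (suppnum (Q j))) / of_real (Im (rou n 1))" for z j
    using mem_points_Int_iff[of "conormal (Q j)" "rou n 1" z "suppnum (Q j)" "suppnum (Q (j + 1))"]
      Im_rou_1_pos[OF n] unit[of j] by (simp flip: step)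
  then have "\<exists>!z. z \<in> points (Q j) \<inter> points (Q (j + 1))" for j
    by simp
  moreover have "Q (j + int n) = Q j" for j
    using n per con[of j] con[of "j + int n"] rou_periodic[of n j 1] by (intro prod_eqI) auto
  moreover have "conormal (Q (j + 1)) = cis (2 * pi / real n) * conormal (Q j)" for j
    using step[of j] by (simp only: rou_1_eq_cis mult.commute)
  ultimately show "equiangular_hedgehog n Q"
    using unit unfolding equiangular_hedgehog_def cooriented_polygon_def by blast
qed

lemma vertex_eq:
  assumes "equiangular_hedgehog n Q"
  shows "vertex Q j = \<i> * conormal (Q j)
     * (of_real (suppnum (Q (j + 1))) - rou n 1 * of_real (suppnum (Q j))) / of_real (Im (rou n 1))"
proof -
  have step: "conormal (Q (j + 1)) = conormal (Q j) * rou n 1" and unit: "norm (conormal (Q j)) = 1"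
    using assms by (auto simp: equiangular_hedgehog_def cooriented_polygon_def rou_1_eq_cis)
  have s: "Im (rou n 1) \<noteq> 0"
    using Im_rou_1_pos[of n] assms unfolding equiangular_hedgehog_iff by linarith
  have "z \<in> points (Q j) \<inter> points (Q (j + 1)) \<longleftrightarrow> z = \<i> * conormal (Q j)
     * (of_real (suppnum (Q (j + 1))) - rou n 1 * of_real (suppnum (Q j))) / of_real (Im (rou n 1))" for z
    using mem_points_Int_iff[OF unit norm_rou s, of z "suppnum (Q j)" "suppnum (Q (j + 1))"]
    by (simp flip: step)
  then show ?thesis unfolding vertex_def by simp
qed

text \<open>Both endpoints of side \<open>j\<close> are now written with the normal of that side as
  a common factor, so their difference and midpoint can be read off.\<close>

lemma vertex_pred_eq:
  assumes "equiangular_hedgehog n Q"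
  shows "vertex Q (j - 1) = \<i> * conormal (Q j)
     * (cnj (rou n 1) * of_real (suppnum (Q j)) - of_real (suppnum (Q (j - 1)))) / of_real (Im (rou n 1))"
proof -
  have "conormal (Q (j - 1 + 1)) = rou n 1 * conormal (Q (j - 1))"
    using assms unfolding equiangular_hedgehog_def rou_1_eq_cis by blast
  then have "conormal (Q (j - 1)) = conormal (Q j) * cnj (rou n 1)" by (simp add: mult_ac)
  moreover have "cnj (rou n 1) * (p - rou n 1 * q) = cnj (rou n 1) * p - q" for p q
    by (simp add: algebra_simps flip: mult.assoc)
  ultimately show ?thesis
    using vertex_eq[OF assms, of "j - 1"] by (simp add: mult.assoc)
qed

lemma inner_rotated: "norm (a::complex) = 1 \<Longrightarrow> (a * x) \<bullet> (a * y) = x \<bullet> y"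
proof -
  assume "norm a = 1"
  then have 1: "Re a * Re a + Im a * Im a = 1"
    by (simp add: cmod_def power2_eq_square)
  have "(a * x) \<bullet> (a * y) = (Re a * Re a + Im a * Im a) * (x \<bullet> y)"
    by (simp add: inner_complex_def algebra_simps)
  then show ?thesis by (simp only: 1 mult_1)
qed

lemma side_vector_eq:
  assumes "equiangular_hedgehog n Q"
  shows "vertex Q j - vertex Q (j - 1) = of_real ((suppnum (Q (j + 1)) + suppnum (Q (j - 1))
     - 2 * Re (rou n 1) * suppnum (Q j)) / Im (rou n 1)) * direction (Q j)"
proof -
  have e: "P - rou n 1 * q - (cnj (rou n 1) * q - r) = P + r - of_real (2 * Re (rou n 1)) * q" for P q r
    unfolding complex_add_cnj[symmetric] by (simp add: algebra_simps)
  show ?thesis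
    unfolding vertex_eq[OF assms, of j] vertex_pred_eq[OF assms, of j] direction_def
      diff_divide_distrib[symmetric] right_diff_distrib[symmetric] e
    by simp
qed

text \<open>The side vector is a real multiple of the unit direction, and that multiple carries
  exactly the sign prescribed by the case distinction. Signed lengths thereby become linear in the
  support numbers.\<close>

lemma side_length_eq:
  assumes "equiangular_hedgehog n Q"
  shows "side_length Q j = (suppnum (Q (j + 1)) + suppnum (Q (j - 1))
     - 2 * Re (rou n 1) * suppnum (Q j)) / Im (rou n 1)"
proof -
  define l where "l = (suppnum (Q (j + 1)) + suppnum (Q (j - 1))
     - 2 * Re (rou n 1) * suppnum (Q j)) / Im (rou n 1)"
  have v: "vertex Q j - vertex Q (j - 1) = l *\<^sub>R direction (Q j)"
    unfolding l_def side_vector_eq[OF assms] by (simp add: scaleR_conv_of_real)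
  have d: "norm (direction (Q j)) = 1"
    using assms by (simp add: direction_def norm_mult equiangular_hedgehog_def cooriented_polygon_def)
  have "dist (vertex Q (j - 1)) (vertex Q j) = \<bar>l\<bar>"
    using d by (simp add: dist_commute[of "vertex Q (j - 1)"] dist_norm[of "vertex Q j"] v)
  moreover have "(vertex Q j - vertex Q (j - 1)) \<bullet> direction (Q j) = l"
    using d by (simp add: v dot_square_norm)
  ultimately show ?thesis by (auto simp: side_length_def simp flip: l_def)
qed

lemma P_evolute_eq:
  assumes "equiangular_hedgehog n Q"
  shows "P_evolute Q j =
     (\<i> * conormal (Q j), (suppnum (Q (j + 1)) - suppnum (Q (j - 1))) / (2 * Im (rou n 1)))"
proof -
  \<comment> \<open>These are the coordinates of the midpoint in the frame with first axis
    \<open>\<i> * conormal (Q j)\<close>. The real part is the support number of the bisector; the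
    imaginary part expresses that the midpoint lies on side \<open>j\<close>.\<close>
  let ?m = "Complex ((suppnum (Q (j + 1)) - suppnum (Q (j - 1))) / (2 * Im (rou n 1))) (- suppnum (Q j))"
  have s: "Im (rou n 1) \<noteq> 0"
    using Im_rou_1_pos[of n] assms unfolding equiangular_hedgehog_iff by linarith
  have a: "norm (\<i> * conormal (Q j)) = 1"
    using assms by (simp add: norm_mult equiangular_hedgehog_def cooriented_polygon_def)
  have e: "cnj (rou n 1) * q - r + (P - rou n 1 * q) = P - r - of_real (2 * Im (rou n 1)) * \<i> * q" for P q r
    unfolding complex_diff_cnj[symmetric] by (simp add: algebra_simps)
  have m: "?m = (of_real (suppnum (Q (j + 1))) - of_real (suppnum (Q (j - 1)))
      - of_real (2 * Im (rou n 1)) * \<i> * of_real (suppnum (Q j))) / of_real (2 * Im (rou n 1))"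
    using s by (simp add: complex_eq_iff)
  have "midpoint (vertex Q (j - 1)) (vertex Q j) = (\<i> * conormal (Q j)) * ?m"
    unfolding m vertex_eq[OF assms, of j] vertex_pred_eq[OF assms, of j] midpoint_def
      add_divide_distrib[symmetric] distrib_left[symmetric] e
    by (simp add: scaleR_conv_of_real)
  then show ?thesis
    using inner_rotated[OF a, of ?m 1] by (simp add: P_evolute_def inner_complex_def)
qed

text \<open>An involute is only required to be a cooriented polygon. The evolute turns all normals
  by the same quarter turn, so equal angles pass back to the involute.\<close>

lemma equiangular_hedgehog_of_evolute:
  assumes "cooriented_polygon n R" and "equiangular_hedgehog n (P_evolute R)"
  shows "equiangular_hedgehog n R"
  using assms by (auto simp: equiangular_hedgehog_def P_evolute_def)

subsection \<open>Evolvents in terms of harmonics\<close>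

lemma rou_mult_nat: "rou n (a * int j) = rou n a ^ j"
  by (induction j) (simp_all add: rou_add algebra_simps)

lemma rou_half: "even n \<Longrightarrow> n > 0 \<Longrightarrow> rou n (int (n div 2)) = -1"
  by (auto simp: rou_def elim!: evenE)

lemma dft_0: "dft n 0 p = of_real (\<Sum>j=1..n. p (int j))"
  by (simp add: dft_def)

lemma dft_half:
  assumes "even n" "n > 0"
  shows "dft n (n div 2) p = of_real (\<Sum>j=1..n. (-1) ^ j * p (int j))"
proof -
  have "rou n (- (int (n div 2) * int j)) = (-1) ^ j" for j
    unfolding rou_minus rou_mult_nat rou_half[OF assms] by simp
  then show ?thesis by (simp add: dft_def mult.commute)
qed

text \<open>The common form of the hypotheses of both parts; evolvents satisfy it again, which makes
  the iteration possible.\<close>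

definition centered :: "nat \<Rightarrow> polygon \<Rightarrow> bool" where
  "centered n Q \<longleftrightarrow> equiangular_hedgehog n Q \<and> harmonic n 0 Q = 0 \<and>
     (even n \<longrightarrow> harmonic n (n div 2) Q = 0)"

lemma equiangular_hedgehogD:
  assumes "equiangular_hedgehog n Q"
  shows "3 \<le> n" "norm (conormal (Q j)) = 1" "suppnum (Q (j + int n)) = suppnum (Q j)"
    "conormal (Q j) = conormal (Q 0) * rou n j"
proof -
  show "3 \<le> n" using assms unfolding equiangular_hedgehog_iff by blast
  show "norm (conormal (Q j)) = 1"
    using assms by (simp add: equiangular_hedgehog_def cooriented_polygon_def)
  show "suppnum (Q (j + int n)) = suppnum (Q j)"
    using assms unfolding equiangular_hedgehog_iff by blast
  show "conormal (Q j) = conormal (Q 0) * rou n j"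
    using assms unfolding equiangular_hedgehog_iff by blast
qed

text \<open>Side lengths are a second difference of the support numbers, hence a Fourier multiplier.
  It vanishes for \<open>k = 1\<close>, as translations leave the sides unchanged, but not at the
  orders 0 and \<open>n/2\<close>, where it is applied below.\<close>

lemma dft_side_length:
  assumes "equiangular_hedgehog n Q"
  shows "dft n k (side_length Q) = of_real (2 * (Re (rou n k) - Re (rou n 1)) / Im (rou n 1)) * harmonic n k Q"
proof -
  let ?p = "\<lambda>j. suppnum (Q j)"
  note Q = equiangular_hedgehogD[OF assms]
  have n: "n > 0" using Q(1) by simp
  have "dft n k (side_length Q) = dft n k (\<lambda>j. 1 / Im (rou n 1) *
      (?p (j + 1) + ?p (j - 1) - 2 * Re (rou n 1) * ?p j))"
    by (simp add: side_length_eq[OF assms, abs_def])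
  also have "\<dots> = of_real (1 / Im (rou n 1)) *
      (rou n k * dft n k ?p + rou n (- int k) * dft n k ?p - of_real (2 * Re (rou n 1)) * dft n k ?p)"
    unfolding dft_scale dft_diff dft_add using dft_shift[OF n, of ?p k] dft_shift_back[OF n, of ?p k] Q(3)
    by simp
  also have "\<dots> = of_real (1 / Im (rou n 1)) *
      ((rou n k + cnj (rou n k)) - of_real (2 * Re (rou n 1))) * dft n k ?p"
    by (simp add: rou_minus algebra_simps)
  finally show ?thesis
    unfolding complex_add_cnj by (simp add: harmonic_eq_dft algebra_simps diff_divide_distrib)
qed

lemma Re_rou_1:
  assumes "3 \<le> n"
  shows "Re (rou n 1) \<noteq> 1" "Re (rou n 1) \<noteq> -1"
proof -
  have "Re (rou n 1) ^ 2 + Im (rou n 1) ^ 2 = 1"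
    using norm_rou[of n 1] by (simp add: cmod_def)
  then show "Re (rou n 1) \<noteq> 1" "Re (rou n 1) \<noteq> -1"
    using Im_rou_1_pos[OF assms] by auto
qed

lemma sum_side_length_eq_0_iff:
  assumes "equiangular_hedgehog n Q"
  shows "(\<Sum>j=1..n. side_length Q (int j)) = 0 \<longleftrightarrow> harmonic n 0 Q = 0"
proof -
  have "(\<Sum>j=1..n. side_length Q (int j)) = 0 \<longleftrightarrow> dft n 0 (side_length Q) = 0"
    unfolding dft_0 by (simp only: of_real_eq_0_iff)
  also have "\<dots> \<longleftrightarrow> harmonic n 0 Q = 0"
    using Re_rou_1[OF equiangular_hedgehogD(1)[OF assms]] Im_rou_1_pos[OF equiangular_hedgehogD(1)[OF assms]]
    unfolding dft_side_length[OF assms] by simp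
  finally show ?thesis .
qed

lemma alternating_sum_side_length_eq_0_iff:
  assumes "equiangular_hedgehog n Q" and "even n"
  shows "(\<Sum>j=1..n. (-1) ^ j * side_length Q (int j)) = 0 \<longleftrightarrow> harmonic n (n div 2) Q = 0"
proof -
  have n: "3 \<le> n" "n > 0" using equiangular_hedgehogD(1)[OF assms(1)] by simp_all
  have "(\<Sum>j=1..n. (-1) ^ j * side_length Q (int j)) = 0 \<longleftrightarrow> dft n (n div 2) (side_length Q) = 0"
    unfolding dft_half[OF assms(2) n(2)] by (simp only: of_real_eq_0_iff)
  also have "\<dots> \<longleftrightarrow> harmonic n (n div 2) Q = 0"
    using Re_rou_1[OF n(1)] Im_rou_1_pos[OF n(1)]
    unfolding dft_side_length[OF assms(1)] rou_half[OF assms(2) n(2)] by (simp add: complex_eq_iff)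
  finally show ?thesis .
qed

lemma zero_perimeter_hedgehogs_eq: "odd n \<Longrightarrow> zero_perimeter_hedgehogs n = {Q. centered n Q}"
  using sum_side_length_eq_0_iff
  by (auto simp: zero_perimeter_hedgehogs_def centered_def perimeter_def)

text \<open>The total and the alternating sum of the lengths are the even partial sum plus and minus
  the odd one, so either pair vanishes with the other.\<close>

lemma balanced_hedgehogs_eq:
  assumes "even n"
  shows "balanced_hedgehogs n = {Q. centered n Q}"
proof -
  have "(\<Sum>j | j \<in> {1..n} \<and> odd j. f j) = 0 \<and> (\<Sum>j | j \<in> {1..n} \<and> even j. f j) = 0 \<longleftrightarrow>
        (\<Sum>j=1..n. f j) = 0 \<and> (\<Sum>j=1..n. (-1) ^ j * f j) = 0" for f :: "nat \<Rightarrow> real"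
  proof -
    have split: "(\<Sum>j=1..n. g j) = (\<Sum>j | j \<in> {1..n} \<and> odd j. g j) + (\<Sum>j | j \<in> {1..n} \<and> even j. g j)"
      for g :: "nat \<Rightarrow> real"
      by (subst sum.union_disjoint[symmetric]) (auto intro!: sum.cong)
    have "(\<Sum>j | j \<in> {1..n} \<and> odd j. (-1) ^ j * f j) = - (\<Sum>j | j \<in> {1..n} \<and> odd j. f j)"
      "(\<Sum>j | j \<in> {1..n} \<and> even j. (-1) ^ j * f j) = (\<Sum>j | j \<in> {1..n} \<and> even j. f j)"
      unfolding sum_negf[symmetric] by (auto intro!: sum.cong)
    then show ?thesis unfolding split by linarith
  qed
  then show ?thesis
    using sum_side_length_eq_0_iff alternating_sum_side_length_eq_0_iff assms
    unfolding balanced_hedgehogs_def centered_def by blast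
qed

lemma suppnum_expansion:
  assumes "centered n Q"
  shows "suppnum (Q j) = (\<Sum>k\<in>orders n. wave n k (2 / of_nat n * harmonic n k Q) j)"
  unfolding harmonic_eq_dft
proof (rule wave_expansion[where p = "\<lambda>j. suppnum (Q j)"])
  have Q: "equiangular_hedgehog n Q" using assms by (simp add: centered_def)
  show "n > 0" "\<And>j. suppnum (Q (j + int n)) = suppnum (Q j)"
    using equiangular_hedgehogD(1,3)[OF Q] by auto
  show "dft n 0 (\<lambda>j. suppnum (Q j)) = 0" "even n \<Longrightarrow> dft n (n div 2) (\<lambda>j. suppnum (Q j)) = 0"
    using assms by (auto simp: centered_def harmonic_eq_dft)
qed

definition evolvent_factor :: "nat \<Rightarrow> nat \<Rightarrow> complex"
  where "evolvent_factor n k = - \<i> * of_real (Im (rou n 1) / Im (rou n (int k)))"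

lemma evolvent_factor_nonzero: "k \<in> orders n \<Longrightarrow> evolvent_factor n k \<noteq> 0"
  using Im_rou_pos[of k n] Im_rou_1_pos[of n]
  by (auto simp: evolvent_factor_def orders_def)

text \<open>The last claim is the Fourier transform of \<open>P_evolute R = Q\<close>: a central
  difference multiplies order \<open>k\<close> by \<open>2 * \<i> * Im (rou n k)\<close>, which is
  nonzero on \<open>orders n\<close> and can be divided out.\<close>

lemma P_evolventD:
  assumes "equiangular_hedgehog n Q" and "P_evolvent n Q R"
  shows "centered n R" and "conormal (R j) = - \<i> * conormal (Q j)"
    and "k \<in> orders n \<Longrightarrow> harmonic n k R = evolvent_factor n k * harmonic n k Q"
proof -
  have R: "cooriented_polygon n R" "P_evolute R = Q"
    and sum0: "(\<Sum>j=1..n. suppnum (R (int j))) = 0"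
    and sum1: "even n \<Longrightarrow> (\<Sum>j=1..n. (-1) ^ j * suppnum (R (int j))) = 0"
    using assms(2) by (simp_all add: P_evolvent_def P_involute_def)
  have eq: "equiangular_hedgehog n R"
    using equiangular_hedgehog_of_evolute[OF R(1)] R(2) assms(1) by simp
  note D = equiangular_hedgehogD[OF eq]
  have n: "n > 0" "3 \<le> n" using D(1) by simp_all
  show "centered n R"
    using n eq sum0 sum1 by (simp add: centered_def harmonic_eq_dft dft_0 dft_half
        del: of_real_sum of_real_mult of_real_power)
  have Qj: "Q j = (\<i> * conormal (R j), (suppnum (R (j + 1)) - suppnum (R (j - 1))) / (2 * Im (rou n 1)))" for j
    using P_evolute_eq[OF eq, of j] unfolding R(2) .
  then show "conormal (R j) = - \<i> * conormal (Q j)" by simp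
  assume k: "k \<in> orders n"
  let ?r = "\<lambda>j. suppnum (R j)"
  have "harmonic n k Q = dft n k (\<lambda>j. 1 / (2 * Im (rou n 1)) * (?r (j + 1) - ?r (j - 1)))"
    by (simp add: harmonic_eq_dft Qj)
  also have "\<dots> = of_real (1 / (2 * Im (rou n 1))) * (rou n k * dft n k ?r - rou n (- int k) * dft n k ?r)"
    unfolding dft_scale dft_diff
    using dft_shift[OF n(1), of ?r k] dft_shift_back[OF n(1), of ?r k] D(3) by simp
  also have "\<dots> = of_real (1 / (2 * Im (rou n 1))) * (rou n k - cnj (rou n k)) * harmonic n k R"
    by (simp only: rou_minus left_diff_distrib right_diff_distrib harmonic_eq_dft mult.assoc)
  finally show "harmonic n k R = evolvent_factor n k * harmonic n k Q"
    using Im_rou_pos[OF k] Im_rou_1_pos[OF n(2)] unfolding complex_diff_cnj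
    by (simp add: evolvent_factor_def mult_ac)
qed

lemma wave_step: "wave n k A (j + 1) - wave n k A (j - 1) = wave n k (2 * \<i> * of_real (Im (rou n (int k))) * A) j"
proof -
  have "wave n k A (j + 1) - wave n k A (j - 1) = Re (A * rou n (int k * j) * (rou n (int k) - cnj (rou n (int k))))"
    by (simp only: wave_def distrib_left right_diff_distrib rou_add rou_minus diff_conv_add_uminus)
       (simp add: algebra_simps rou_minus)
  also have "A * rou n (int k * j) * (rou n (int k) - cnj (rou n (int k))) = 
     2 * \<i> * of_real (Im (rou n (int k))) * A * rou n (int k * j)"
    unfolding complex_diff_cnj by simp
  finally show ?thesis by (simp only: wave_def)
qed

lemma P_evolvent_exists:
  assumes "centered n Q"
  shows "\<exists>R. P_evolvent n Q R"
proof -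
  have Q: "equiangular_hedgehog n Q" using assms by (simp add: centered_def)
  note D = equiangular_hedgehogD[OF Q]
  define A where "A k = evolvent_factor n k * (2 / of_nat n * harmonic n k Q)" for k
  \<comment> \<open>The factor \<open>- \<i>\<close> undoes the quarter turn of the normals made by
    the evolute; \<open>A k\<close> undoes its effect on each harmonic.\<close>
  define R where "R j = (- \<i> * conormal (Q j), \<Sum>k\<in>orders n. wave n k (A k) j)" for j
  have n: "n > 0" "3 \<le> n" using D(1) by simp_all
  have "conormal (R j) = conormal (R 0) * rou n j" for j
    using D(4)[of j] by (simp add: R_def)
  moreover have "norm (conormal (R 0)) = 1" "suppnum (R (j + int n)) = suppnum (R j)" for j
    using n D(2)[of 0] by (simp_all add: R_def norm_mult wave_periodic)
  ultimately have R: "equiangular_hedgehog n R"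
    unfolding equiangular_hedgehog_iff using n(2) by blast
  have "(suppnum (R (j + 1)) - suppnum (R (j - 1))) / (2 * Im (rou n 1)) = suppnum (Q j)" for j
  proof -
    have "suppnum (R (j + 1)) - suppnum (R (j - 1)) = (\<Sum>k\<in>orders n. wave n k (A k) (j + 1) - wave n k (A k) (j - 1))"
      by (simp add: R_def sum_subtractf)
    also have "\<dots> = (\<Sum>k\<in>orders n. 2 * Im (rou n 1) * wave n k (2 / of_nat n * harmonic n k Q) j)"
    proof (rule sum.cong[OF refl])
      fix k assume k: "k \<in> orders n"
      have "2 * \<i> * of_real (Im (rou n (int k))) * A k = of_real (2 * Im (rou n 1)) * (2 / of_nat n * harmonic n k Q)"
        using Im_rou_pos[OF k] by (simp add: A_def evolvent_factor_def)
      then show "wave n k (A k) (j + 1) - wave n k (A k) (j - 1)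
          = 2 * Im (rou n 1) * wave n k (2 / of_nat n * harmonic n k Q) j"
        unfolding wave_step by (simp only: wave_def mult.assoc) simp
    qed
    also have "\<dots> = 2 * Im (rou n 1) * suppnum (Q j)"
      by (simp add: suppnum_expansion[OF assms] sum_distrib_left)
    finally show ?thesis using Im_rou_1_pos[OF n(2)] by simp
  qed
  then have "P_evolute R = Q"
    by (intro ext prod_eqI) (simp_all add: P_evolute_eq[OF R], simp add: R_def)
  \<comment> \<open>Since \<open>R\<close> is composed of waves with orders in
    \<open>orders n\<close> only, the two normalizing sums of an evolvent vanish.\<close>
  moreover have dftR: "dft n k (\<lambda>j. suppnum (R j)) = (if k \<in> orders n then of_nat n / 2 * A k else 0)" if "2 * k \<le> n" for k
    using that by (simp add: R_def dft_sum dft_wave if_distrib cong: if_cong)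
  then have "dft n 0 (\<lambda>j. suppnum (R j)) = 0" "even n \<Longrightarrow> dft n (n div 2) (\<lambda>j. suppnum (R j)) = 0"
    by (auto simp: orders_def elim!: evenE)
  then have "(\<Sum>j=1..n. suppnum (R (int j))) = 0 \<and>
     (even n \<longrightarrow> (\<Sum>j=1..n. (-1) ^ j * suppnum (R (int j))) = 0)"
    using n by (simp add: dft_0 dft_half del: of_real_sum of_real_mult of_real_power)
  ultimately have "P_evolvent n Q R"
    using R by (simp add: P_evolvent_def P_involute_def equiangular_hedgehog_def)
  then show ?thesis by blast
qed

text \<open>An evolvent is itself centered, so its harmonics on \<open>orders n\<close>, which
  \<open>Q\<close> prescribes, determine its support numbers.\<close>

lemma P_evolvent_unique:
  assumes "centered n Q"
  shows "\<exists>!R. P_evolvent n Q R"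
proof -
  have Q: "equiangular_hedgehog n Q" using assms by (simp add: centered_def)
  have "R = R'" if R: "P_evolvent n Q R" "P_evolvent n Q R'" for R R'
  proof (intro ext prod_eqI)
    fix j
    show "conormal (R j) = conormal (R' j)"
      using P_evolventD(2)[OF Q R(1)] P_evolventD(2)[OF Q R(2)] by simp
    show "suppnum (R j) = suppnum (R' j)"
      unfolding suppnum_expansion[OF P_evolventD(1)[OF Q R(1)]] suppnum_expansion[OF P_evolventD(1)[OF Q R(2)]]
      using P_evolventD(3)[OF Q R(1)] P_evolventD(3)[OF Q R(2)] by (intro sum.cong) simp_all
  qed
  then show ?thesis using P_evolvent_exists[OF assms] by blast
qed

lemma centered_iterated_evolvents:
  assumes "centered n Q" and "iterated_evolvents n Q S"
  shows "centered n (S t)"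
proof (induction t)
  case (Suc t)
  then show ?case
    using P_evolventD(1)[of n "S t" "S (Suc t)"] assms(2) by (auto simp: iterated_evolvents_def centered_def)
qed (use assms in \<open>simp add: iterated_evolvents_def\<close>)

text \<open>The operator \<open>E\<close> is meaningful on centered hedgehogs only, hence the
  induction showing that its iterates from \<open>Q\<close> stay among them.\<close>

lemma iterated_evolvents_unique:
  assumes "centered n Q"
  shows "\<exists>!S. iterated_evolvents n Q S"
proof -
  define E where "E R = (THE R'. P_evolvent n R R')" for R
  have E: "P_evolvent n R R' \<longleftrightarrow> R' = E R" if "centered n R" for R R'
    unfolding E_def using P_evolvent_unique[OF that] by (metis theI_unique)
  define S where "S t = (E ^^ t) Q" for t
  have "centered n (S t)" for t
  proof (induction t)
    case (Suc t)
    then show ?case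
      using P_evolventD(1)[of n "S t" "S (Suc t)"] E[of "S t" "S (Suc t)"] by (simp add: S_def centered_def)
  qed (use assms in \<open>simp add: S_def\<close>)
  then have "iterated_evolvents n Q S"
    by (simp add: iterated_evolvents_def E) (simp add: S_def)
  moreover have "T = S" if T: "iterated_evolvents n Q T" for T
  proof
    fix t
    show "T t = S t"
    proof (induction t)
      case (Suc t)
      then show ?case
        using T E[OF centered_iterated_evolvents[OF assms T]] by (simp add: iterated_evolvents_def S_def)
    qed (use T in \<open>simp add: iterated_evolvents_def S_def\<close>)
  qed
  ultimately show ?thesis by blast
qed

subsection \<open>Vertices of iterated evolvents\<close>

text \<open>Fourier truncation of \<open>Q\<close> to the orders in \<open>K\<close>, with its
  normals kept. It serves both to split the vertices into harmonic contributions and to provide the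
  limit polygons.\<close>

definition band :: "nat \<Rightarrow> polygon \<Rightarrow> nat set \<Rightarrow> polygon" where
  "band n Q K j = (conormal (Q j), \<Sum>k\<in>K. wave n k (2 / of_nat n * harmonic n k Q) j)"

lemma equiangular_hedgehogI:
  assumes "3 \<le> n" "norm (conormal (Q 0)) = 1" "\<And>j. conormal (Q j) = conormal (Q 0) * rou n j"
    "\<And>j. suppnum (Q (j + int n)) = suppnum (Q j)"
  shows "equiangular_hedgehog n Q"
  unfolding equiangular_hedgehog_iff using assms by blast

lemma equiangular_hedgehog_band:
  assumes "equiangular_hedgehog n Q"
  shows "equiangular_hedgehog n (band n Q K)"
proof (rule equiangular_hedgehogI)
  note Q = equiangular_hedgehogD[OF assms]
  show "conormal (band n Q K j) = conormal (band n Q K 0) * rou n j" for j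
    using Q(4)[of j] by (simp add: band_def)
  show "3 \<le> n" by (rule Q(1))
  then show "suppnum (band n Q K (j + int n)) = suppnum (band n Q K j)" for j
    by (simp add: band_def wave_periodic)
  show "norm (conormal (band n Q K 0)) = 1" using Q(2) by (simp add: band_def)
qed

lemma band_orders: "centered n Q \<Longrightarrow> band n Q (orders n) = Q"
  by (intro ext prod_eqI) (simp_all only: band_def fst_conv snd_conv suppnum_expansion[symmetric])

lemma vertex_band:
  assumes "equiangular_hedgehog n Q"
  shows "vertex (band n Q K) j = (\<Sum>k\<in>K. vertex (band n Q {k}) j)"
proof -
  have "vertex (band n Q K) j = (\<Sum>k\<in>K. \<i> * conormal (Q j) * (of_real (wave n k (2 / of_nat n * harmonic n k Q) (j + 1))
      - rou n 1 * of_real (wave n k (2 / of_nat n * harmonic n k Q) j)) / of_real (Im (rou n 1)))"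
    unfolding vertex_eq[OF equiangular_hedgehog_band[OF assms]]
    by (simp add: band_def sum_distrib_left flip: sum_subtractf sum_divide_distrib)
  then show ?thesis
    unfolding vertex_eq[OF equiangular_hedgehog_band[OF assms]] by (simp add: band_def)
qed

lemma vertex_band_zero:
  assumes "equiangular_hedgehog n Q" and "harmonic n k Q = 0"
  shows "vertex (band n Q {k}) j = 0"
  unfolding vertex_eq[OF equiangular_hedgehog_band[OF assms(1)]]
  using assms(2) by (simp add: band_def wave_def)

lemma harmonic_band:
  assumes "K \<subseteq> orders n" and "2 * k \<le> n" and "n > 0"
  shows "harmonic n k (band n Q K) = (if k \<in> K then harmonic n k Q else 0)"
proof -
  have "harmonic n k (band n Q K) = (\<Sum>m\<in>K. if k = m then harmonic n k Q else 0)"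
    unfolding harmonic_eq_dft band_def snd_conv dft_sum
    using assms by (intro sum.cong) (auto simp: dft_wave)
  also have "\<dots> = (if k \<in> K then harmonic n k Q else 0)"
    using finite_subset[OF assms(1)] by simp
  finally show ?thesis .
qed

lemma vertex_on_side:
  assumes "cooriented_polygon n Q"
  shows "vertex Q j \<bullet> conormal (Q j) = suppnum (Q j)"
proof -
  have "\<exists>!z. z \<in> points (Q j) \<inter> points (Q (j + 1))"
    using assms by (simp add: cooriented_polygon_def)
  from theI'[OF this] show ?thesis by (simp add: vertex_def points_def)
qed

text \<open>Translating a hedgehog by \<open>z\<close> thus changes its support numbers by a wave of
  order 1.\<close>

lemma inner_conormal_eq_wave:
  "z \<bullet> (u * rou n j) = wave n 1 (cnj z * u) j"
  by (simp add: wave_def inner_complex_def algebra_simps)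

text \<open>If all sides pass through one point, the support numbers form a wave of order 1 and have
  no other harmonic.\<close>

lemma not_point_polygon:
  assumes "equiangular_hedgehog n L" and "k \<in> orders n" "k \<noteq> 1" and "harmonic n k L \<noteq> 0"
  shows "\<not> point_polygon L"
proof
  assume "point_polygon L"
  then obtain z where "\<And>j. vertex L j = z" by (auto simp: point_polygon_def)
  then have "suppnum (L j) = z \<bullet> conormal (L j)" for j
    using vertex_on_side[of n L j] assms(1) by (simp add: equiangular_hedgehog_def)
  then have "suppnum (L j) = wave n 1 (cnj z * conormal (L 0)) j" for j
    using equiangular_hedgehogD(4)[OF assms(1), of j] by (simp add: inner_conormal_eq_wave)
  then have "harmonic n k L = dft n k (wave n 1 (cnj z * conormal (L 0)))"
    by (simp add: harmonic_eq_dft)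
  also have "\<dots> = 0"
    using assms(2,3) equiangular_hedgehogD(1)[OF assms(1)] dft_wave[of 1 n k]
    by (auto simp: orders_def)
  finally show False using assms(4) by simp
qed

text \<open>Summing against the turning normals is a conjugate Fourier sum of order 1. The shift in
  the vertex formula contributes \<open>cnj w - w = -2 * \<i> * Im w\<close> with
  \<open>w = rou n 1\<close>, which cancels the denominator.\<close>

lemma vertex_centroid_eq:
  assumes "equiangular_hedgehog n Q"
  shows "vertex_centroid n Q = 2 / of_nat n * conormal (Q 0) * cnj (harmonic n 1 Q)"
proof -
  let ?p = "\<lambda>j. suppnum (Q j)" and ?s = "Im (rou n 1)"
  note Q = equiangular_hedgehogD[OF assms]
  have n: "n > 0" and s: "?s > 0" using Q(1) Im_rou_1_pos by auto
  have shift: "dft n 1 (\<lambda>j. ?p (j + 1)) = rou n 1 * dft n 1 ?p"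
    using dft_shift[OF n, of ?p 1] Q(3) by simp
  have cnj_dft: "(\<Sum>j=1..n. rou n (int j) * of_real (p (int j))) = cnj (dft n 1 p)" for p
    by (simp add: dft_def rou_minus mult.commute)
  have "(\<Sum>j=1..n. vertex Q (int j)) = (\<Sum>j=1..n. \<i> * conormal (Q 0) / of_real ?s *
      (rou n (int j) * of_real (?p (int j + 1)) - rou n 1 * (rou n (int j) * of_real (?p (int j)))))"
  proof (rule sum.cong[OF refl])
    fix j
    show "vertex Q (int j) = \<i> * conormal (Q 0) / of_real ?s *
      (rou n (int j) * of_real (?p (int j + 1)) - rou n 1 * (rou n (int j) * of_real (?p (int j))))"
      unfolding vertex_eq[OF assms] Q(4)[of "int j"] by (simp add: right_diff_distrib diff_divide_distrib mult_ac)
  qed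
  also have "\<dots> = \<i> * conormal (Q 0) / of_real ?s * (cnj (dft n 1 (\<lambda>j. ?p (j + 1))) - rou n 1 * cnj (dft n 1 ?p))"
    unfolding cnj_dft[symmetric] by (simp add: sum_distrib_left sum_subtractf right_diff_distrib)
  also have "\<dots> = \<i> * conormal (Q 0) / of_real ?s * (- (rou n 1 - cnj (rou n 1)) * cnj (dft n 1 ?p))"
    unfolding shift by (simp add: algebra_simps)
  also have "\<dots> = 2 * conormal (Q 0) * cnj (harmonic n 1 Q)"
  proof -
    have "\<i> * u / of_real x * (- (of_real (2 * x) * \<i>) * y) = 2 * u * y" if "x > 0" for u y :: complex and x :: real
      using that by simp
    from this[OF s] show ?thesis unfolding complex_diff_cnj harmonic_eq_dft .
  qed
  finally have "(\<Sum>j=1..n. vertex Q (int j)) = 2 * conormal (Q 0) * cnj (harmonic n 1 Q)" .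
  then show ?thesis
    unfolding vertex_centroid_def by (simp add: scaleR_conv_of_real divide_simps)
qed

lemma vertex_band_1:
  assumes "equiangular_hedgehog n Q"
  shows "vertex (band n Q {1}) j = vertex_centroid n Q"
proof -
  define c where "c = vertex_centroid n Q"
  note Q = equiangular_hedgehogD[OF assms]
  have n: "n > 0" using Q(1) by simp
  have u: "conormal (Q 0) * cnj (conormal (Q 0)) = 1"
    using Q(2)[of 0] by (simp add: complex_norm_square[symmetric])
  have "cnj c * conormal (Q 0) = 2 / of_nat n * harmonic n 1 Q * (conormal (Q 0) * cnj (conormal (Q 0)))"
    by (simp add: c_def vertex_centroid_eq[OF assms])
  then have supp: "suppnum (band n Q {1} i) = c \<bullet> conormal (band n Q {1} i)" for i
    using Q(4)[of i] by (simp add: band_def inner_conormal_eq_wave u)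
  have eq: "equiangular_hedgehog n (band n Q {1})"
    by (rule equiangular_hedgehog_band[OF assms])
  then have "\<exists>!z. z \<in> points (band n Q {1} j) \<inter> points (band n Q {1} (j + 1))"
    by (simp add: equiangular_hedgehog_def cooriented_polygon_def)
  moreover have "c \<in> points (band n Q {1} j) \<inter> points (band n Q {1} (j + 1))"
    by (simp add: points_def supp del: One_nat_def)
  ultimately show ?thesis unfolding vertex_def c_def[symmetric] by (rule the1_equality)
qed

text \<open>The normal acquires \<open>- \<i>\<close>, the conjugated first harmonic acquires
  \<open>\<i>\<close>, and these cancel.\<close>

lemma vertex_centroid_evolvent:
  assumes "equiangular_hedgehog n Q" and "P_evolvent n Q R"
  shows "vertex_centroid n R = vertex_centroid n Q"
proof -
  have n: "3 \<le> n" by (rule equiangular_hedgehogD(1)[OF assms(1)])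
  have R: "equiangular_hedgehog n R"
    using P_evolventD(1)[OF assms] by (simp add: centered_def)
  show ?thesis
    unfolding vertex_centroid_eq[OF assms(1)] vertex_centroid_eq[OF R]
    using P_evolventD(2)[OF assms, of 0] P_evolventD(3)[OF assms one_in_orders[OF n]] Im_rou_1_pos[OF n]
    by (simp add: evolvent_factor_def mult_ac)
qed

section \<open>Growth rates of the harmonics over two evolvent steps\<close>

definition rate :: "nat \<Rightarrow> nat \<Rightarrow> real"
  where "rate n k = (Im (rou n 1) / Im (rou n (int k))) ^ 2"

lemma rate_1: "3 \<le> n \<Longrightarrow> rate n 1 = 1"
  using Im_rou_1_pos[of n] by (simp add: rate_def)

lemma rate_pos: "k \<in> orders n \<Longrightarrow> rate n k > 0"
  using Im_rou_pos[of k n] Im_rou_1_pos[of n] by (auto simp: rate_def orders_def)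

text \<open>The sine of 2 pi k / n peaks at \<open>k = n/4\<close>; writing it as a cosine of the
  distance from there turns comparisons of rates into comparisons of the integers
  \<open>|n - 4k|\<close>.\<close>

lemma Im_rou_eq_cos:
  assumes "n > 0"
  shows "Im (rou n (int k)) = cos (pi * real_of_int \<bar>int n - 4 * int k\<bar> / (2 * real n))"
proof -
  have "pi * real_of_int \<bar>int n - 4 * int k\<bar> / (2 * real n) = \<bar>pi * (real n - 4 * real k) / (2 * real n)\<bar>"
    by (simp add: abs_mult)
  also have "pi * (real n - 4 * real k) / (2 * real n) = pi / 2 - 2 * pi * real k / real n"
    using assms by (simp add: field_simps)
  finally show ?thesis by (simp add: Im_rou sin_cos_eq)
qed

lemma rate_less:
  assumes "k \<in> orders n" "m \<in> orders n" and "\<bar>int n - 4 * int k\<bar> < \<bar>int n - 4 * int m\<bar>"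
  shows "rate n k < rate n m"
proof -
  have n: "n > 0" "3 \<le> n" using assms(1) by (auto simp: orders_def)
  have "real_of_int \<bar>int n - 4 * int k\<bar> < real_of_int \<bar>int n - 4 * int m\<bar>"
    using assms(3) by (simp only: of_int_less_iff)
  moreover have "real_of_int \<bar>int n - 4 * int m\<bar> \<le> 2 * real n"
    using assms(2) by (auto simp: orders_def abs_if)
  ultimately have "Im (rou n (int m)) < Im (rou n (int k))"
    unfolding Im_rou_eq_cos[OF n(1)] using n by (intro cos_monotone_0_pi) (auto simp: divide_simps)
  then show ?thesis
    unfolding rate_def using Im_rou_pos[OF assms(1)] Im_rou_pos[OF assms(2)] Im_rou_1_pos[OF n(2)]
    by (intro power_strict_mono divide_strict_left_mono) auto
qed

lemma rate_eq:
  assumes "k \<in> orders n" and "\<bar>int n - 4 * int k\<bar> = \<bar>int n - 4 * int m\<bar>"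
  shows "rate n k = rate n m"
proof -
  have n: "n > 0" using assms(1) by (auto simp: orders_def)
  show ?thesis unfolding rate_def Im_rou_eq_cos[OF n, of k] Im_rou_eq_cos[OF n, of m] assms(2) ..
qed

lemma wave_scale: "wave n k (of_real c * A) j = c * wave n k A j"
  by (simp add: wave_def mult.assoc)

text \<open>Two steps negate the normals and multiply the support numbers of order \<open>k\<close>
  by \<open>- rate n k\<close>; the two signs cancel in the vertices.\<close>

lemma vertex_band_step:
  assumes "equiangular_hedgehog n Q" "P_evolvent n Q R" "P_evolvent n R T" "k \<in> orders n"
  shows "vertex (band n T {k}) j = rate n k *\<^sub>R vertex (band n Q {k}) j"
proof -
  have R: "equiangular_hedgehog n R"
    using P_evolventD(1)[OF assms(1,2)] by (simp add: centered_def)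
  have T: "equiangular_hedgehog n T"
    using P_evolventD(1)[OF R assms(3)] by (simp add: centered_def)
  have con: "conormal (T i) = - conormal (Q i)" for i
    using P_evolventD(2)[OF assms(1,2), of i] P_evolventD(2)[OF R assms(3), of i] by simp
  have "evolvent_factor n k * evolvent_factor n k = - of_real (rate n k)"
    by (simp add: evolvent_factor_def rate_def power2_eq_square mult_ac)
  then have "harmonic n k T = - of_real (rate n k) * harmonic n k Q"
    using P_evolventD(3)[OF assms(1,2,4)] P_evolventD(3)[OF R assms(3,4)] by (simp flip: mult.assoc)
  then have "wave n k (2 / of_nat n * harmonic n k T) i = - rate n k * wave n k (2 / of_nat n * harmonic n k Q) i" for i
    using wave_scale[of n k "- rate n k" "2 / of_nat n * harmonic n k Q" i] by (simp add: mult_ac)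
  then have "suppnum (band n T {k} i) = - rate n k * suppnum (band n Q {k} i)" for i
    by (simp add: band_def)
  moreover have "conormal (band n T {k} j) = - conormal (band n Q {k} j)"
    using con by (simp add: band_def)
  ultimately show ?thesis
    unfolding vertex_eq[OF equiangular_hedgehog_band[OF T]] vertex_eq[OF equiangular_hedgehog_band[OF assms(1)]]
    by (simp add: scaleR_conv_of_real algebra_simps diff_divide_distrib)
qed

lemma vertex_band_iterate:
  assumes "centered n Q" and "iterated_evolvents n Q S" and "k \<in> orders n"
  shows "vertex (band n (S (2 * t)) {k}) j = rate n k ^ t *\<^sub>R vertex (band n Q {k}) j"
proof (induction t)
  case (Suc t)
  have "equiangular_hedgehog n (S (2 * t))"
    using centered_iterated_evolvents[OF assms(1,2)] by (simp add: centered_def)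
  then show ?case
    using vertex_band_step[of n "S (2 * t)" "S (Suc (2 * t))" "S (Suc (Suc (2 * t)))" k j] assms(2,3) Suc
    by (simp add: iterated_evolvents_def)
qed (use assms(2) in \<open>simp add: iterated_evolvents_def\<close>)

lemma vertex_iterate:
  assumes "centered n Q" and "iterated_evolvents n Q S"
  shows "vertex (S (2 * t)) j - vertex_centroid n Q
    = (\<Sum>k\<in>orders n - {1}. rate n k ^ t *\<^sub>R vertex (band n Q {k}) j)"
proof -
  have Q: "equiangular_hedgehog n Q" using assms(1) by (simp add: centered_def)
  have n: "3 \<le> n" by (rule equiangular_hedgehogD(1)[OF Q])
  have S: "centered n (S (2 * t))" by (rule centered_iterated_evolvents[OF assms])
  then have "vertex (S (2 * t)) j = (\<Sum>k\<in>orders n. vertex (band n (S (2 * t)) {k}) j)"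
    using vertex_band[of n "S (2 * t)" "orders n" j] band_orders[OF S] by (simp add: centered_def)
  also have "\<dots> = (\<Sum>k\<in>orders n. rate n k ^ t *\<^sub>R vertex (band n Q {k}) j)"
    by (simp add: vertex_band_iterate[OF assms])
  also have "\<dots> = vertex_centroid n Q + (\<Sum>k\<in>orders n - {1}. rate n k ^ t *\<^sub>R vertex (band n Q {k}) j)"
    using sum.remove[OF finite_orders one_in_orders[OF n], of "\<lambda>k. rate n k ^ t *\<^sub>R vertex (band n Q {k}) j"]
    by (simp only: rate_1[OF n] vertex_band_1[OF Q] power_one scaleR_one)
  finally show ?thesis by simp
qed

lemma iterate_asymptotics:
  assumes "centered n Q" and "iterated_evolvents n Q S"
    and K: "K \<subseteq> orders n - {1}" and r: "r > 0" "\<And>k. k \<in> K \<Longrightarrow> rate n k = r"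
    and dom: "\<And>k. k \<in> orders n - {1} - K \<Longrightarrow> harmonic n k Q = 0 \<or> rate n k < r"
  shows "(\<lambda>t. (1 / r) ^ t *\<^sub>R (vertex (S (2 * t)) j - vertex_centroid n Q)) \<longlonglongrightarrow> vertex (band n Q K) j"
proof -
  have Q: "equiangular_hedgehog n Q" using assms(1) by (simp add: centered_def)
  have "(\<lambda>t. \<Sum>k\<in>orders n - {1}. (rate n k / r) ^ t *\<^sub>R vertex (band n Q {k}) j)
      \<longlonglongrightarrow> (\<Sum>k\<in>orders n - {1}. if k \<in> K then vertex (band n Q {k}) j else 0)"
  proof (rule tendsto_sum)
    fix k assume k: "k \<in> orders n - {1}"
    show "(\<lambda>t. (rate n k / r) ^ t *\<^sub>R vertex (band n Q {k}) j)
        \<longlonglongrightarrow> (if k \<in> K then vertex (band n Q {k}) j else 0)"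
    proof (cases "k \<in> K")
      case True
      then show ?thesis using r by simp
    next
      case False
      with dom k consider "harmonic n k Q = 0" | "rate n k < r" by blast
      then show ?thesis
      proof cases
        case 1
        then show ?thesis using False by (simp add: vertex_band_zero[OF Q])
      next
        case 2
        then have "(\<lambda>t. (rate n k / r) ^ t) \<longlonglongrightarrow> 0"
          using r rate_pos[of k n] k by (intro LIMSEQ_realpow_zero) auto
        from tendsto_scaleR[OF this tendsto_const] False show ?thesis by simp
      qed
    qed
  qed
  also have "(\<lambda>t. \<Sum>k\<in>orders n - {1}. (rate n k / r) ^ t *\<^sub>R vertex (band n Q {k}) j)
      = (\<lambda>t. (1 / r) ^ t *\<^sub>R (vertex (S (2 * t)) j - vertex_centroid n Q))"
    by (simp add: vertex_iterate[OF assms(1,2)] scaleR_sum_right power_divide)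
  also have "(\<Sum>k\<in>orders n - {1}. if k \<in> K then vertex (band n Q {k}) j else 0) = vertex (band n Q K) j"
    unfolding vertex_band[OF Q, of K]
    using K by (subst sum.inter_restrict[symmetric]) (auto intro!: sum.cong)
  finally show ?thesis .
qed

subsection \<open>Limit shapes\<close>

text \<open>Transfers statements about even steps to odd steps: the shifted sequence starts at
  \<open>S 1\<close>, which has the same centroid and the same vanishing harmonics.\<close>

lemma next_evolvent:
  assumes "centered n Q" and "iterated_evolvents n Q S"
  shows "centered n (S 1)" "iterated_evolvents n (S 1) (\<lambda>t. S (Suc t))"
    "vertex_centroid n (S 1) = vertex_centroid n Q" "conormal (S 1 j) = - \<i> * conormal (Q j)"
    "k \<in> orders n \<Longrightarrow> harmonic n k (S 1) = 0 \<longleftrightarrow> harmonic n k Q = 0"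
proof -
  have Q: "equiangular_hedgehog n Q" using assms(1) by (simp add: centered_def)
  have "P_evolvent n (S 0) (S (Suc 0))" and "S 0 = Q"
    using assms(2) unfolding iterated_evolvents_def by blast+
  then have E: "P_evolvent n Q (S 1)" by simp
  show "centered n (S 1)" by (rule P_evolventD(1)[OF Q E])
  show "iterated_evolvents n (S 1) (\<lambda>t. S (Suc t))"
    using assms(2) by (simp add: iterated_evolvents_def)
  show "vertex_centroid n (S 1) = vertex_centroid n Q"
    by (rule vertex_centroid_evolvent[OF Q E])
  show "conormal (S 1 j) = - \<i> * conormal (Q j)"
    by (rule P_evolventD(2)[OF Q E])
  show "harmonic n k (S 1) = 0 \<longleftrightarrow> harmonic n k Q = 0" if "k \<in> orders n"
    using P_evolventD(3)[OF Q E that] evolvent_factor_nonzero[OF that] by simp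
qed

lemma band_not_point_polygon:
  assumes "equiangular_hedgehog n Q" and "K \<subseteq> orders n" and "k \<in> K" "k \<noteq> 1" "harmonic n k Q \<noteq> 0"
  shows "\<not> point_polygon (band n Q K)"
proof (rule not_point_polygon[OF equiangular_hedgehog_band[OF assms(1)] _ assms(4)])
  show "k \<in> orders n" using assms(2,3) by blast
  then show "harmonic n k (band n Q K) \<noteq> 0"
    using harmonic_band[OF assms(2), of k] assms(3,5) by (auto simp: orders_def)
qed

lemma tends_in_shape_band:
  assumes "centered n Q" and "iterated_evolvents n Q S"
    and K: "K \<subseteq> orders n - {1}" and r: "r > 0" "\<And>k. k \<in> K \<Longrightarrow> rate n k = r"
    and dom: "\<And>k. k \<in> orders n - {1} - K \<Longrightarrow> harmonic n k Q = 0 \<or> rate n k < r"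
    and "m \<in> K" "harmonic n m Q \<noteq> 0"
  shows "tends_in_shape_to (\<lambda>t. S (2 * t)) (band n Q K)"
proof -
  have "\<not> point_polygon (band n Q K)"
    using assms(1,7,8) K by (intro band_not_point_polygon[of n Q K m]) (auto simp: centered_def)
  moreover have "\<exists>s c. (\<forall>t. s t > (0::real)) \<and>
      (\<forall>j. (\<lambda>t. s t *\<^sub>R (vertex (S (2 * t)) j - c t)) \<longlonglongrightarrow> vertex (band n Q K) j)"
    using iterate_asymptotics[OF assms(1,2) K r dom] r(1)
    by (intro exI[of _ "\<lambda>t. (1 / r) ^ t"] exI[of _ "\<lambda>t. vertex_centroid n Q"]) auto
  ultimately show ?thesis by (simp add: tends_in_shape_to_def)
qed

lemma tends_in_shape_bands:
  assumes "centered n Q" and "iterated_evolvents n Q S"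
    and K: "K \<subseteq> orders n - {1}" and r: "r > 0" "\<And>k. k \<in> K \<Longrightarrow> rate n k = r"
    and dom: "\<And>k. k \<in> orders n - {1} - K \<Longrightarrow> harmonic n k Q = 0 \<or> rate n k < r"
    and m: "m \<in> K" "harmonic n m Q \<noteq> 0"
  shows "tends_in_shape_to (\<lambda>t. S (2 * t)) (band n Q K)"
    and "tends_in_shape_to (\<lambda>t. S (2 * t + 1)) (band n (S 1) K)"
proof -
  show "tends_in_shape_to (\<lambda>t. S (2 * t)) (band n Q K)"
    by (rule tends_in_shape_band[OF assms])
  note N = next_evolvent[OF assms(1,2)]
  have "tends_in_shape_to (\<lambda>t. S (Suc (2 * t))) (band n (S 1) K)"
    by (rule tends_in_shape_band[OF N(1,2) K r _ m(1)]) (use dom m K N(5) in auto)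
  then show "tends_in_shape_to (\<lambda>t. S (2 * t + 1)) (band n (S 1) K)" by simp
qed

lemma eventually_even_odd:
  assumes "\<forall>\<^sub>F t in sequentially. P (2 * t)" and "\<forall>\<^sub>F t in sequentially. P (2 * t + 1)"
  shows "\<forall>\<^sub>F t in sequentially. P t"
proof -
  obtain M N where M: "\<And>t. t \<ge> M \<Longrightarrow> P (2 * t)" and N: "\<And>t. t \<ge> N \<Longrightarrow> P (2 * t + 1)"
    using assms unfolding eventually_sequentially by blast
  have "P t" if "t \<ge> 2 * M + 2 * N" for t
    using M[of "t div 2"] N[of "t div 2"] that by (cases "even t") auto
  then show ?thesis unfolding eventually_sequentially by blast
qed

lemma filterlim_even_odd:
  assumes "filterlim (\<lambda>t. f (2 * t)) F sequentially" and "filterlim (\<lambda>t. f (2 * t + 1)) F sequentially"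
  shows "filterlim f F sequentially"
  unfolding filterlim_iff
proof (intro allI impI)
  fix P assume P: "eventually P F"
  show "\<forall>\<^sub>F t in sequentially. P (f t)"
    by (rule eventually_even_odd) (use assms P in \<open>auto simp: filterlim_iff\<close>)
qed

lemma shrinks_to_vertex_centroid:
  assumes "centered n Q" and "iterated_evolvents n Q S"
    and dom: "\<And>k. k \<in> orders n - {1} \<Longrightarrow> harmonic n k Q = 0 \<or> rate n k < 1"
  shows "shrinks_to S (vertex_centroid n Q)"
proof -
  have "(\<lambda>t. vertex (S (2 * t)) j) \<longlonglongrightarrow> vertex_centroid n Q"
    if "centered n Q" "iterated_evolvents n Q S"
      "\<And>k. k \<in> orders n - {1} \<Longrightarrow> harmonic n k Q = 0 \<or> rate n k < 1" for Q S j
  proof -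
    have Q: "equiangular_hedgehog n Q" using that(1) by (simp add: centered_def)
    have "vertex (band n Q {}) j = 0" unfolding vertex_band[OF Q, of "{}"] by simp
    \<comment> \<open>With \<open>K\<close> empty and \<open>r = 1\<close> every order other than 1
      dies out, without rescaling.\<close>
    then have "(\<lambda>t. vertex (S (2 * t)) j - vertex_centroid n Q) \<longlonglongrightarrow> 0"
      using iterate_asymptotics[OF that(1,2), of "{}" 1 j] that(3) by simp
    then show ?thesis using Lim_null by blast
  qed
  note even = this
  note N = next_evolvent[OF assms(1,2)]
  have odd: "(\<lambda>t. vertex (S (Suc (2 * t))) j) \<longlonglongrightarrow> vertex_centroid n Q" for j
    unfolding N(3)[symmetric] by (rule even[OF N(1,2)]) (use dom N(5) in auto)
  show ?thesis
    unfolding shrinks_to_def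
  proof
    fix j
    show "(\<lambda>t. vertex (S t) j) \<longlonglongrightarrow> vertex_centroid n Q"
      by (rule filterlim_even_odd) (use even[OF assms] odd in auto)
  qed
qed

lemma vertex_iterate_constant:
  assumes "centered n Q" and "iterated_evolvents n Q S"
    and zero: "\<And>k. k \<in> orders n - {1} \<Longrightarrow> harmonic n k Q = 0"
  shows "vertex (S (2 * t)) j = vertex_centroid n Q" "vertex (S (2 * t + 1)) j = vertex_centroid n Q"
proof -
  have even: "vertex (S (2 * t)) j = vertex_centroid n Q"
    if "centered n Q" "iterated_evolvents n Q S"
      "\<And>k. k \<in> orders n - {1} \<Longrightarrow> harmonic n k Q = 0" for Q S
  proof -
    have Q: "equiangular_hedgehog n Q" using that(1) by (simp add: centered_def)
    have "vertex (S (2 * t)) j - vertex_centroid n Q = 0"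
      unfolding vertex_iterate[OF that(1,2)]
      by (rule sum.neutral) (use that(3) vertex_band_zero[OF Q] in simp)
    then show ?thesis by simp
  qed
  show "vertex (S (2 * t)) j = vertex_centroid n Q" by (rule even[OF assms])
  note N = next_evolvent[OF assms(1,2)]
  have "vertex (S (Suc (2 * t))) j = vertex_centroid n Q"
    unfolding N(3)[symmetric] by (rule even[OF N(1,2)]) (use zero N(5) in auto)
  then show "vertex (S (2 * t + 1)) j = vertex_centroid n Q" by simp
qed

lemma tends_to_constant:
  assumes "\<And>t j. vertex (T t) j = z" and "\<And>j. vertex L j = z"
  shows "tends_to T L" and "tends_in_shape_to T L"
proof -
  show "tends_to T L" by (simp add: tends_to_def assms)
  have "point_polygon (T t)" for t using assms(1) by (auto simp: point_polygon_def)
  then show "tends_in_shape_to T L"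
    unfolding tends_in_shape_to_def
    by (intro conjI exI[of _ "\<lambda>_. 1"] exI[of _ "\<lambda>_. 0"]) (simp_all add: assms)
qed

section \<open>Unbounded diameters, and limits that are not homothetic\<close>

lemma finite_vertices:
  assumes "equiangular_hedgehog n Q"
  shows "finite (range (vertex Q))"
proof -
  have n: "n > 0" using equiangular_hedgehogD(1)[OF assms] by simp
  have Q: "Q (j + int n) = Q j" for j
    using assms by (simp add: equiangular_hedgehog_def cooriented_polygon_def)
  have "vertex Q (j + int n) = vertex Q j" for j
    using Q[of j] Q[of "j + 1"] by (simp add: vertex_def algebra_simps)
  from periodic_int[where f = "vertex Q", OF this]
  have per: "vertex Q j = vertex Q (j mod int n)" for j
    by (metis mod_mult_div_eq)
  have "range (vertex Q) \<subseteq> vertex Q ` {0..<int n}"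
  proof
    fix z assume "z \<in> range (vertex Q)"
    then obtain j where "z = vertex Q j" by blast
    moreover have "j mod int n \<in> {0..<int n}" using n by simp
    ultimately show "z \<in> vertex Q ` {0..<int n}" using per[of j] by blast
  qed
  then show ?thesis by (rule finite_subset) simp
qed

text \<open>Two distinct vertices of the limit shape have a positive distance; undoing the rescaling
  multiplies it by about \<open>r ^ t\<close>, and it bounds the diameter from below. Finiteness of
  the vertex set makes that bound legitimate.\<close>

lemma diameter_at_top:
  assumes "\<And>t. equiangular_hedgehog n (T t)" and r: "r > 1" and "\<not> point_polygon L"
    and lim: "\<And>j. (\<lambda>t. (1 / r) ^ t *\<^sub>R (vertex (T t) j - c)) \<longlonglongrightarrow> vertex L j"
  shows "filterlim (\<lambda>t. diameter (range (vertex (T t)))) at_top sequentially"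
proof -
  obtain i j where ij: "vertex L i \<noteq> vertex L j"
    using assms(3) unfolding point_polygon_def by metis
  have "(\<lambda>t. dist ((1 / r) ^ t *\<^sub>R (vertex (T t) i - c)) ((1 / r) ^ t *\<^sub>R (vertex (T t) j - c)))
      \<longlonglongrightarrow> dist (vertex L i) (vertex L j)"
    by (intro tendsto_dist lim)
  moreover have "filterlim (\<lambda>t. r ^ t) at_top sequentially"
    by (rule filterlim_at_infinity_imp_filterlim_at_top[OF filterlim_realpow_sequentially_gt1])
       (use r in auto)
  ultimately have "filterlim (\<lambda>t. dist ((1 / r) ^ t *\<^sub>R (vertex (T t) i - c)) ((1 / r) ^ t *\<^sub>R (vertex (T t) j - c)) * r ^ t)
      at_top sequentially"
    using ij by (intro filterlim_tendsto_pos_mult_at_top[where c = "dist (vertex L i) (vertex L j)"]) auto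
  also have "(\<lambda>t. dist ((1 / r) ^ t *\<^sub>R (vertex (T t) i - c)) ((1 / r) ^ t *\<^sub>R (vertex (T t) j - c)) * r ^ t)
      = (\<lambda>t. dist (vertex (T t) i) (vertex (T t) j))"
    using r by (simp add: dist_norm power_divide flip: scaleR_right_diff_distrib)
  finally show ?thesis
    by (rule filterlim_at_top_mono)
       (auto intro!: always_eventually diameter_bounded_bound finite_imp_bounded finite_vertices[OF assms(1)])
qed

text \<open>A homothety keeps side directions, yet corresponding sides are perpendicular. All sides
  then have length zero, so the polygon is a point.\<close>

lemma not_homothetic:
  assumes "equiangular_hedgehog n L0" "equiangular_hedgehog n L1"
    and con: "\<And>j. conormal (L1 j) = - \<i> * conormal (L0 j)" and "\<not> point_polygon L0"
  shows "\<not> homothetic L0 L1"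
proof
  assume "homothetic L0 L1"
  then obtain s c where s: "s > 0" and v: "\<And>j. vertex L1 j = s *\<^sub>R vertex L0 j + c"
    unfolding homothetic_def by blast
  define l where "l Q j = (suppnum (Q (j + 1)) + suppnum (Q (j - 1)) - 2 * Re (rou n 1) * suppnum (Q j)) / Im (rou n 1)"
    for Q and j :: int
  have side: "vertex L0 j - vertex L0 (j - 1) = of_real (l L0 j) * (\<i> * conormal (L0 j))"
    "vertex L1 j - vertex L1 (j - 1) = of_real (l L1 j) * (\<i> * conormal (L1 j))" for j
    unfolding l_def side_vector_eq[OF assms(1)] side_vector_eq[OF assms(2)] direction_def by simp_all
  have "vertex L0 j = vertex L0 (j - 1)" for j
  proof -
    have "of_real (l L1 j) * (\<i> * conormal (L1 j)) = s *\<^sub>R (vertex L0 j - vertex L0 (j - 1))"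
      unfolding side(2)[symmetric] by (simp add: v scaleR_right_diff_distrib)
    \<comment> \<open>Relative to the common normal, the side of \<open>L1\<close> is real and the
      scaled side of \<open>L0\<close> imaginary, so both vanish.\<close>
    then have "(of_real (l L1 j) - of_real s * of_real (l L0 j) * \<i>) * conormal (L0 j) = 0"
      unfolding side(1) con by (simp add: scaleR_conv_of_real algebra_simps)
    moreover have "conormal (L0 j) \<noteq> 0"
      using equiangular_hedgehogD(2)[OF assms(1), of j] by auto
    ultimately have "of_real (l L1 j) - of_real s * of_real (l L0 j) * \<i> = 0"
      by (metis mult_eq_0_iff)
    then have "l L0 j = 0" using s by (simp add: complex_eq_iff)
    then show ?thesis using side(1)[of j] by simp
  qed
  then have step: "vertex L0 (j + 1) = vertex L0 j" for j
    by (metis add_diff_cancel_right')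
  have "vertex L0 j = vertex L0 0" for j
  proof (induction j rule: int_induct[where k = 0])
    case (step2 i)
    then show ?case using step[of "i - 1"] by simp
  qed (simp_all add: step)
  then show False using assms(4) by (auto simp: point_polygon_def)
qed

section \<open>Bands as discrete hypocycloids\<close>

lemma discrete_hypocycloidI:
  assumes "equiangular_hedgehog n L" and "m \<in> orders n" and "A \<noteq> 0"
    and supp: "\<And>j. suppnum (L j) = c \<bullet> conormal (L j) + wave n m A j"
  shows "discrete_hypocycloid n m L"
proof -
  note L = equiangular_hedgehogD[OF assms(1)]
  define \<phi> where "\<phi> = Arg (conormal (L 0))"
  have u: "conormal (L 0) = cis \<phi>"
  proof -
    have "conormal (L 0) \<noteq> 0" using L(2)[of 0] by auto
    then show ?thesis using cis_Arg L(2)[of 0] by (simp add: \<phi>_def sgn_eq)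
  qed
  \<comment> \<open>The phase shift compensates for measuring angles from the fixed axis instead of
    from the normal of side 0. The sine coefficient is \<open>- Im B\<close> because
    \<open>Re (B * cis x) = Re B * cos x - Im B * sin x\<close>.\<close>
  define B where "B = A * cis (- (real m * \<phi>))"
  have "L j = hypocycloid_tangent c m (Re B) (- Im B) (\<phi> + 2 * pi * real_of_int j / real n)" for j
  proof -
    let ?\<alpha> = "\<phi> + 2 * pi * real_of_int j / real n"
    have con: "conormal (L j) = cis ?\<alpha>"
      using L(4)[of j] by (simp add: u rou_def cis_mult)
    have "cis (- (real m * \<phi>)) * cis (real m * ?\<alpha>) = rou n (int m * j)"
      unfolding cis_mult rou_def by (rule arg_cong[where f = cis]) (simp add: algebra_simps)
    then have "wave n m A j = Re (B * cis (real m * ?\<alpha>))"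
      by (simp add: wave_def B_def mult.assoc)
    then show ?thesis
      using con supp[of j] by (intro prod_eqI) (simp_all add: hypocycloid_tangent_def coline_def)
  qed
  moreover have "B \<noteq> 0" using assms(3) by (simp add: B_def)
  then have "(Re B, - Im B) \<noteq> (0, 0)" by (simp add: complex_eq_iff)
  ultimately have "\<exists>c a b. (a, b) \<noteq> (0, 0) \<and> (\<forall>j. \<exists>\<alpha>. L j = hypocycloid_tangent c m a b \<alpha>)"
    by blast
  then show ?thesis
    using assms(1,2) by (simp add: discrete_hypocycloid_def orders_def)
qed

lemma suppnum_band_1:
  assumes "equiangular_hedgehog n Q"
  shows "wave n 1 (2 / of_nat n * harmonic n 1 Q) j = vertex_centroid n Q \<bullet> conormal (Q j)"
proof -
  have "cooriented_polygon n (band n Q {1})"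
    using equiangular_hedgehog_band[OF assms] unfolding equiangular_hedgehog_def by blast
  from vertex_on_side[OF this, of j] show ?thesis
    unfolding vertex_band_1[OF assms] by (simp add: band_def)
qed

lemma discrete_hypocycloid_band:
  assumes "equiangular_hedgehog n Q" and "m \<in> orders n" and "harmonic n m Q \<noteq> 0"
  shows "discrete_hypocycloid n m (band n Q {m})"
proof (rule discrete_hypocycloidI[OF equiangular_hedgehog_band[OF assms(1)] assms(2)])
  show "suppnum (band n Q {m} j) = 0 \<bullet> conormal (band n Q {m} j) + wave n m (2 / of_nat n * harmonic n m Q) j" for j
    by (simp add: band_def)
qed (use assms in \<open>auto simp: orders_def\<close>)

text \<open>The part of order 1 places the center of the hypocycloid at the vertex centroid.\<close>

lemma discrete_hypocycloid_band_1_insert: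
  assumes "equiangular_hedgehog n Q" and "m \<in> orders n" and "m \<noteq> 1" and "harmonic n m Q \<noteq> 0"
  shows "discrete_hypocycloid n m (band n Q {1, m})"
proof (rule discrete_hypocycloidI[OF equiangular_hedgehog_band[OF assms(1)] assms(2)])
  show "suppnum (band n Q {1, m} j) = vertex_centroid n Q \<bullet> conormal (band n Q {1, m} j)
      + wave n m (2 / of_nat n * harmonic n m Q) j" for j
    using assms(3) suppnum_band_1[OF assms(1), of j] by (simp add: band_def)
qed (use assms in \<open>auto simp: orders_def\<close>)

lemma discrete_hypocycloid_band_1:
  assumes "equiangular_hedgehog n Q"
  shows "discrete_hypocycloid n 1 (band n Q {1})"
proof (rule discrete_hypocycloidI[OF equiangular_hedgehog_band[OF assms] one_in_orders])
  let ?u = "conormal (Q 0)"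
  note Q = equiangular_hedgehogD[OF assms]
  show "3 \<le> n" by (rule Q(1))
  \<comment> \<open>The first harmonic vanishes if the centroid is the origin, but the amplitude
    must be nonzero. Moving the center away from the centroid by the unit vector \<open>?u\<close>
    leaves a wave of amplitude 1 enveloping the same point.\<close>
  have "?u \<bullet> conormal (Q j) = wave n 1 1 j" for j
    using Q(2)[of 0] unfolding Q(4)[of j] inner_conormal_eq_wave
    by (simp add: mult.commute[of "cnj ?u"] complex_norm_square[symmetric] del: One_nat_def)
  then show "suppnum (band n Q {1} j) = (vertex_centroid n Q - ?u) \<bullet> conormal (band n Q {1} j) + wave n 1 1 j" for j
    using suppnum_band_1[OF assms, of j] by (simp add: band_def inner_diff_left)
qed simp

lemma hypocycloid_sum_band:
  assumes "equiangular_hedgehog n Q" and "k \<in> orders n" "m \<in> orders n" and "k \<noteq> m"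
    and "harmonic n k Q \<noteq> 0" "harmonic n m Q \<noteq> 0"
  shows "hypocycloid_sum n k m (band n Q {k, m})"
proof -
  have "conormal (band n Q {k, m} j) = conormal (band n Q {k} j) \<and>
      conormal (band n Q {k, m} j) = conormal (band n Q {m} j) \<and>
      suppnum (band n Q {k, m} j) = suppnum (band n Q {k} j) + suppnum (band n Q {m} j)" for j
    using assms(4) by (simp add: band_def)
  then show ?thesis
    unfolding hypocycloid_sum_def
    using discrete_hypocycloid_band[OF assms(1,2,5)] discrete_hypocycloid_band[OF assms(1,3,6)] by blast
qed

section \<open>Genericity of a nonvanishing harmonic\<close>

lemma continuous_on_harmonic: "continuous_on UNIV (harmonic n k)"
  unfolding harmonic_def[abs_def]
  by (intro continuous_intros continuous_on_product_coordinates)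

lemma generic_harmonic_nonzero:
  assumes "m \<in> orders n"
  shows "generic_in {Q. centered n Q} {Q. centered n Q \<and> harmonic n m Q \<noteq> 0}" (is "generic_in ?X ?G")
proof -
  have "open {Q. harmonic n m Q \<noteq> 0}"
    by (intro open_Collect_neq continuous_on_harmonic continuous_on_const)
  then have "openin (top_of_set ?X) (?X \<inter> {Q. harmonic n m Q \<noteq> 0})"
    by (rule openin_open_Int)
  moreover have cl: "Q \<in> closure ?G" if Q: "centered n Q" for Q
  proof (cases "harmonic n m Q = 0")
    case True
    \<comment> \<open>Adding a small wave of order \<open>m\<close> changes that harmonic alone
      among the orders up to \<open>n/2\<close>, so the perturbed hedgehog stays centered and lies
      in the open set.\<close>
    define f where "f e j = (conormal (Q j), suppnum (Q j) + e * wave n m 1 j)" for e j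
    have eq: "equiangular_hedgehog n Q" using Q by (simp add: centered_def)
    note D = equiangular_hedgehogD[OF eq]
    have f: "equiangular_hedgehog n (f e)" for e
    proof (rule equiangular_hedgehogI)
      show "conormal (f e j) = conormal (f e 0) * rou n j" for j
        using D(4)[of j] by (simp add: f_def)
      show "suppnum (f e (j + int n)) = suppnum (f e j)" for j
        using D(1,3) by (simp add: f_def wave_periodic)
    qed (use D(1,2) in \<open>simp_all add: f_def\<close>)
    have harm: "harmonic n k (f e) = harmonic n k Q + of_real e * (if k = m then of_nat n / 2 else 0)"
      if "2 * k \<le> n" for k e
      using dft_wave[OF assms that, of 1] by (simp add: harmonic_eq_dft f_def dft_add dft_scale)
    have "f e \<in> ?G" if "e \<noteq> 0" for e
      using Q f that True assms D(1) by (auto simp: centered_def harm orders_def)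
    then have "f ` (- {0}) \<subseteq> closure ?G"
      using closure_subset by blast
    moreover have "continuous_on UNIV f"
      unfolding f_def by (intro continuous_on_coordinatewise_then_product continuous_intros)
    ultimately have "f ` closure (- {0}) \<subseteq> closure ?G"
      by (intro image_closure_subset) (auto intro: continuous_on_subset)
    then have "f 0 \<in> closure ?G" by (auto simp: closure_complement)
    also have "f 0 = Q" by (intro ext prod_eqI) (simp_all add: f_def)
    finally show ?thesis .
  next
    case False
    with Q show ?thesis by (intro subsetD[OF closure_subset]) simp
  qed
  moreover have "?X \<inter> {Q. harmonic n m Q \<noteq> 0} = ?G" by blast
  ultimately have "openin (top_of_set ?X) ?G" by simp
  moreover have "?X \<subseteq> closure ?G" using cl by blast
  ultimately show ?thesis unfolding generic_in_def ..
qed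

subsection \<open>The odd and the even case\<close>

lemma odd_case:
  assumes "odd n" and "centered n Q" and m: "m = (n - 1) div 2" and h: "harmonic n m Q \<noteq> 0"
    and S: "iterated_evolvents n Q S"
  shows "(n > 3 \<longrightarrow> expands S) \<and>
    (\<exists>L0 L1. discrete_hypocycloid n m L0 \<and> discrete_hypocycloid n m L1 \<and>
       (n > 3 \<longrightarrow> \<not> homothetic L0 L1) \<and>
       tends_in_shape_to (\<lambda>k. S (2 * k)) L0 \<and> tends_in_shape_to (\<lambda>k. S (2 * k + 1)) L1)"
proof -
  have Q: "equiangular_hedgehog n Q" using assms(2) by (simp add: centered_def)
  have n: "3 \<le> n" by (rule equiangular_hedgehogD(1)[OF Q])
  have nm: "n = 2 * m + 1" using assms(1) m by (auto elim!: oddE)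
  then have mo: "m \<in> orders n" using n by (auto simp: orders_def)
  note N = next_evolvent[OF assms(2) S]
  have Q1: "equiangular_hedgehog n (S 1)" using N(1) by (simp add: centered_def)
  have h1: "harmonic n m (S 1) \<noteq> 0" using N(5)[OF mo] h by simp
  have D: "discrete_hypocycloid n m (band n Q {m})" "discrete_hypocycloid n m (band n (S 1) {m})"
    by (rule discrete_hypocycloid_band[OF Q mo h], rule discrete_hypocycloid_band[OF Q1 mo h1])
  show ?thesis
  proof (cases "n = 3")
    case True
    then have m1: "m = 1" using nm by simp
    then have "harmonic n k Q = 0" if "k \<in> orders n - {1}" for k
      using that True by (auto simp: orders_def)
    then have C: "vertex (S (2 * t)) j = vertex_centroid n Q" "vertex (S (2 * t + 1)) j = vertex_centroid n Q" for t j
      using vertex_iterate_constant[OF assms(2) S] by blast+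
    have "tends_in_shape_to (\<lambda>k. S (2 * k)) (band n Q {1})"
      by (rule tends_to_constant(2)[where z = "vertex_centroid n Q"]) (rule C(1), rule vertex_band_1[OF Q])
    moreover have "tends_in_shape_to (\<lambda>k. S (2 * k + 1)) (band n (S 1) {1})"
      by (rule tends_to_constant(2)[where z = "vertex_centroid n Q"])
         (rule C(2), use vertex_band_1[OF Q1] N(3) in metis)
    ultimately show ?thesis using D True unfolding m1 by blast
  next
    case False
    then have n5: "n \<ge> 5" using n nm by presburger
    then have K: "{m} \<subseteq> orders n - {1}" using mo nm by auto
    \<comment> \<open>Here \<open>|n - 4 * m| = n - 2\<close>, while every other order gives at most
      \<open>n - 4\<close>, the value for order 1.\<close>
    have less: "rate n k < rate n m" if "k \<in> orders n" "k \<noteq> m" for k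
      using that nm n5 by (intro rate_less[OF _ mo]) (auto simp: orders_def)
    have r1: "rate n m > 1"
      using less[of 1] one_in_orders[OF n] rate_1[OF n] nm n5 by simp
    have dom: "\<And>k. k \<in> orders n - {1} - {m} \<Longrightarrow> harmonic n k R = 0 \<or> rate n k < rate n m" for R
      using less by auto
    have m1: "m \<noteq> 1" using K by blast
    have sub: "{m} \<subseteq> orders n" using mo by blast
    note np = band_not_point_polygon[OF Q sub singletonI m1 h] band_not_point_polygon[OF Q1 sub singletonI m1 h1]
    have r: "\<And>k. k \<in> {m} \<Longrightarrow> rate n k = rate n m" by simp
    note T = tends_in_shape_bands[OF assms(2) S K rate_pos[OF mo] r dom singletonI h]
    have "tends_in_shape_to (\<lambda>k. S (2 * k)) (band n Q {m})" by (rule T(1))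
    moreover have "tends_in_shape_to (\<lambda>k. S (2 * k + 1)) (band n (S 1) {m})" by (rule T(2))
    moreover have "\<not> homothetic (band n Q {m}) (band n (S 1) {m})"
      by (rule not_homothetic[OF equiangular_hedgehog_band[OF Q] equiangular_hedgehog_band[OF Q1] _ np(1)])
         (simp add: band_def N(4) del: One_nat_def)
    moreover have "expands S"
      unfolding expands_def
    proof (rule filterlim_even_odd)
      have eq: "equiangular_hedgehog n (S t)" for t
        using centered_iterated_evolvents[OF assms(2) S] by (simp add: centered_def)
      have lim: "(\<lambda>t. (1 / rate n m) ^ t *\<^sub>R (vertex (S (2 * t)) j - vertex_centroid n Q))
            \<longlonglongrightarrow> vertex (band n Q {m}) j"
          "(\<lambda>t. (1 / rate n m) ^ t *\<^sub>R (vertex (S (Suc (2 * t))) j - vertex_centroid n (S 1)))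
            \<longlonglongrightarrow> vertex (band n (S 1) {m}) j" for j
        by (rule iterate_asymptotics[OF assms(2) S K rate_pos[OF mo] r dom], assumption+)
           (rule iterate_asymptotics[OF N(1,2) K rate_pos[OF mo] r dom], assumption+)
      show "filterlim (\<lambda>t. diameter (range (vertex (S (2 * t))))) at_top sequentially"
        by (rule diameter_at_top[OF eq r1 np(1) lim(1)])
      have "filterlim (\<lambda>t. diameter (range (vertex (S (Suc (2 * t)))))) at_top sequentially"
        by (rule diameter_at_top[OF eq r1 np(2) lim(2)])
      then show "filterlim (\<lambda>t. diameter (range (vertex (S (2 * t + 1))))) at_top sequentially"
        by simp
    qed
    ultimately show ?thesis using D by blast
  qed
qed

lemma even_generic_case:
  assumes "even n" and "centered n Q" and m: "m = n div 2 - 1" and h: "n \<le> 4 \<or> harmonic n m Q \<noteq> 0"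
    and S: "iterated_evolvents n Q S"
  shows "\<exists>L0 L1. discrete_hypocycloid n m L0 \<and> discrete_hypocycloid n m L1 \<and>
       (n > 4 \<longrightarrow> \<not> homothetic L0 L1) \<and>
       tends_to (\<lambda>k. S (2 * k)) L0 \<and> tends_to (\<lambda>k. S (2 * k + 1)) L1"
proof -
  have Q: "equiangular_hedgehog n Q" using assms(2) by (simp add: centered_def)
  have n: "3 \<le> n" by (rule equiangular_hedgehogD(1)[OF Q])
  have nm: "n = 2 * m + 2" using assms(1) m n by (auto elim!: evenE)
  then have mo: "m \<in> orders n" using n by (auto simp: orders_def)
  note N = next_evolvent[OF assms(2) S]
  have Q1: "equiangular_hedgehog n (S 1)" using N(1) by (simp add: centered_def)
  show ?thesis
  proof (cases "n = 4")
    case True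
    then have m1: "m = 1" using nm by simp
    then have "harmonic n k Q = 0" if "k \<in> orders n - {1}" for k
      using that True by (auto simp: orders_def)
    then have C: "vertex (S (2 * t)) j = vertex_centroid n Q" "vertex (S (2 * t + 1)) j = vertex_centroid n Q" for t j
      using vertex_iterate_constant[OF assms(2) S] by blast+
    have "tends_to (\<lambda>k. S (2 * k)) (band n Q {1})"
      by (rule tends_to_constant(1)[where z = "vertex_centroid n Q"]) (rule C(1), rule vertex_band_1[OF Q])
    moreover have "tends_to (\<lambda>k. S (2 * k + 1)) (band n (S 1) {1})"
      by (rule tends_to_constant(1)[where z = "vertex_centroid n Q"])
         (rule C(2), use vertex_band_1[OF Q1] N(3) in metis)
    ultimately show ?thesis
      using discrete_hypocycloid_band_1[OF Q] discrete_hypocycloid_band_1[OF Q1] True unfolding m1 by blast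
  next
    case False
    then have n6: "n \<ge> 6" using n nm by presburger
    then have h0: "harmonic n m Q \<noteq> 0" using h by simp
    have h1: "harmonic n m (S 1) \<noteq> 0" using N(5)[OF mo] h0 by simp
    have m1: "m \<noteq> 1" using n6 nm by simp
    then have K: "{m} \<subseteq> orders n - {1}" using mo by auto
    \<comment> \<open>With \<open>n = 2 * m + 2\<close> both \<open>|n - 4 * m|\<close> and
      \<open>|n - 4|\<close> equal \<open>2 * m - 2\<close>.\<close>
    have r: "rate n k = 1" if "k \<in> {m}" for k
    proof -
      have "rate n m = rate n 1" by (rule rate_eq[OF mo]) (use nm in auto)
      then show ?thesis using that rate_1[OF n] by simp
    qed
    have dom: "harmonic n k R = 0 \<or> rate n k < 1" if "k \<in> orders n - {1} - {m}" for k R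
    proof -
      have "rate n k < rate n 1"
        using that nm n6 by (intro rate_less[OF _ one_in_orders[OF n]]) (auto simp: orders_def)
      then show ?thesis using rate_1[OF n] by simp
    qed
    \<comment> \<open>Since the rate is 1, the polygons converge themselves; adding the centroid
      back turns the band \<open>{m}\<close> into \<open>{1, m}\<close>.\<close>
    have lim: "(\<lambda>t. vertex (T (2 * t)) j) \<longlonglongrightarrow> vertex (band n R {1, m}) j"
      if "centered n R" "iterated_evolvents n R T" for R T j
    proof -
      have R: "equiangular_hedgehog n R" using that(1) by (simp add: centered_def)
      have "(\<lambda>t. (1 / 1) ^ t *\<^sub>R (vertex (T (2 * t)) j - vertex_centroid n R)) \<longlonglongrightarrow> vertex (band n R {m}) j"
        by (rule iterate_asymptotics[OF that K]) (use r dom in auto)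
      then have "(\<lambda>t. (vertex (T (2 * t)) j - vertex_centroid n R) + vertex_centroid n R)
          \<longlonglongrightarrow> vertex (band n R {m}) j + vertex_centroid n R"
        by (intro tendsto_intros) simp
      moreover have "vertex (band n R {1, m}) j = vertex (band n R {1}) j + vertex (band n R {m}) j"
        using m1 unfolding vertex_band[OF R, of "{1, m}"] by simp
      ultimately show ?thesis by (simp add: vertex_band_1[OF R] add.commute del: One_nat_def)
    qed
    have "tends_to (\<lambda>k. S (2 * k)) (band n Q {1, m})"
      unfolding tends_to_def using lim[OF assms(2) S] by simp
    moreover have "tends_to (\<lambda>k. S (2 * k + 1)) (band n (S 1) {1, m})"
      unfolding tends_to_def using lim[OF N(1,2)] by simp
    moreover have "\<not> point_polygon (band n Q {1, m})"
      by (rule band_not_point_polygon[OF Q _ _ m1 h0]) (use mo one_in_orders[OF n] in auto)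
    then have "\<not> homothetic (band n Q {1, m}) (band n (S 1) {1, m})"
      by (intro not_homothetic[OF equiangular_hedgehog_band[OF Q] equiangular_hedgehog_band[OF Q1]])
         (simp_all add: band_def N(4) del: One_nat_def)
    ultimately show ?thesis
      using discrete_hypocycloid_band_1_insert[OF Q mo m1 h0] discrete_hypocycloid_band_1_insert[OF Q1 mo m1 h1]
      by blast
  qed
qed

lemma even_degenerate_case:
  assumes "even n" and "centered n Q" and n4: "n > 4" and h: "harmonic n (n div 2 - 1) Q = 0"
    and S: "iterated_evolvents n Q S"
  shows "shrinks_to S (vertex_centroid n Q)"
    and "\<not> resonant n Q \<Longrightarrow> \<exists>m L0 L1. m \<noteq> n div 2 - 1 \<and>
      discrete_hypocycloid n m L0 \<and> discrete_hypocycloid n m L1 \<and>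
      tends_in_shape_to (\<lambda>k. S (2 * k)) L0 \<and> tends_in_shape_to (\<lambda>k. S (2 * k + 1)) L1"
    and "resonant n Q \<Longrightarrow> \<exists>m L0 L1. 2 \<le> m \<and> 4 * m < n \<and>
      hypocycloid_sum n m (n div 2 - m) L0 \<and> hypocycloid_sum n m (n div 2 - m) L1 \<and>
      tends_in_shape_to (\<lambda>k. S (2 * k)) L0 \<and> tends_in_shape_to (\<lambda>k. S (2 * k + 1)) L1"
proof -
  define N where "N = n div 2"
  have nN: "n = 2 * N" using assms(1) by (simp add: N_def)
  have N3: "N \<ge> 3" using n4 nN by simp
  have Q: "equiangular_hedgehog n Q" using assms(2) by (simp add: centered_def)
  have n: "3 \<le> n" using n4 by simp
  note E = next_evolvent[OF assms(2) S]
  have Q1: "equiangular_hedgehog n (S 1)" using E(1) by (simp add: centered_def)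
  have ord: "k \<in> orders n \<longleftrightarrow> 1 \<le> k \<and> k < N" for k
    by (auto simp: orders_def nN)
  show "shrinks_to S (vertex_centroid n Q)"
  proof (rule shrinks_to_vertex_centroid[OF assms(2) S])
    fix k assume k: "k \<in> orders n - {1}"
    show "harmonic n k Q = 0 \<or> rate n k < 1"
    proof (cases "k = N - 1")
      case True
      then show ?thesis using h by (simp add: N_def)
    next
      case False
      then have "2 \<le> k" "k < N - 1" using k by (auto simp: ord)
      then have "rate n k < rate n 1"
        using k by (intro rate_less[OF _ one_in_orders[OF n]]) (auto simp: nN)
      then show ?thesis using rate_1[OF n] by simp
    qed
  qed
  \<comment> \<open>Here \<open>{k, N - k}\<close> is the slowest decaying pair of orders not known
    to vanish, and \<open>K\<close> collects those members that contribute to the limit.\<close>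
  have shape: "tends_in_shape_to (\<lambda>t. S (2 * t)) (band n Q K)"
    "tends_in_shape_to (\<lambda>t. S (2 * t + 1)) (band n (S 1) K)"
    if k: "2 \<le> k" "2 * k \<le> N" and K: "K \<subseteq> {k, N - k}"
      and zero: "\<And>i. 2 \<le> i \<Longrightarrow> i < k \<Longrightarrow> harmonic n i Q = 0 \<and> harmonic n (N - i) Q = 0"
      and rest: "\<And>i. i \<in> {k, N - k} - K \<Longrightarrow> harmonic n i Q = 0"
      and m: "m \<in> K" "harmonic n m Q \<noteq> 0" for k K m
  proof -
    have ko: "k \<in> orders n" using k by (simp add: ord)
    have K': "K \<subseteq> orders n - {1}" using K k by (auto simp: ord)
    have r: "rate n i = rate n k" if "i \<in> K" for i
      using that K K' k by (intro rate_eq) (auto simp: nN)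
    have dom: "harmonic n i Q = 0 \<or> rate n i < rate n k" if i: "i \<in> orders n - {1} - K" for i
    proof -
      \<comment> \<open>Orders farther from \<open>n/4\<close> than \<open>k\<close> have vanishing
        harmonics, those closer to it decay faster. In the second case \<open>i = N - 1\<close> is
        separate: its mirror image is the translational order 1, about which \<open>zero\<close>
        says nothing.\<close>
      consider "i < k" | "N - i < k" | "i \<in> {k, N - k}" | "k < i" "i < N - k"
        using k by fastforce
      then show ?thesis
      proof cases
        case 1
        then show ?thesis using zero[of i] i by (simp add: ord)
      next
        case 2
        show ?thesis
        proof (cases "i = N - 1")
          case True
          then show ?thesis using h by (simp add: N_def)
        next
          case False
          then have "2 \<le> N - i" "N - (N - i) = i" using i by (auto simp: ord)
          then show ?thesis using zero[of "N - i"] 2 by simp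
        qed
      next
        case 3
        then show ?thesis using rest[of i] i by blast
      next
        case 4
        then have "rate n i < rate n k" using i ko k by (intro rate_less) (auto simp: nN)
        then show ?thesis ..
      qed
    qed
    show "tends_in_shape_to (\<lambda>t. S (2 * t)) (band n Q K)"
      "tends_in_shape_to (\<lambda>t. S (2 * t + 1)) (band n (S 1) K)"
      by (rule tends_in_shape_bands[OF assms(2) S K' rate_pos[OF ko] r dom m]; assumption)+
  qed
  show "\<exists>m L0 L1. 2 \<le> m \<and> 4 * m < n \<and>
      hypocycloid_sum n m (n div 2 - m) L0 \<and> hypocycloid_sum n m (n div 2 - m) L1 \<and>
      tends_in_shape_to (\<lambda>k. S (2 * k)) L0 \<and> tends_in_shape_to (\<lambda>k. S (2 * k + 1)) L1"
    if "resonant n Q"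
  proof -
    have "\<exists>k. 2 \<le> k \<and> 4 * k < n \<and> harmonic n k Q \<noteq> 0 \<and> harmonic n (N - k) Q \<noteq> 0 \<and>
        (\<forall>i. 2 \<le> i \<and> i < k \<longrightarrow> harmonic n i Q = 0 \<and> harmonic n (N - i) Q = 0)"
      using that unfolding resonant_def N_def .
    then obtain k where k: "2 \<le> k" "4 * k < n" and hk: "harmonic n k Q \<noteq> 0" "harmonic n (N - k) Q \<noteq> 0"
      and zero: "\<forall>i. 2 \<le> i \<and> i < k \<longrightarrow> harmonic n i Q = 0 \<and> harmonic n (N - i) Q = 0"
      by (elim exE conjE)
    have kN: "2 * k < N" using k nN by simp
    then have o: "k \<in> orders n" "N - k \<in> orders n" "k \<noteq> N - k" using k(1) by (auto simp: ord)
    have hk1: "harmonic n k (S 1) \<noteq> 0" "harmonic n (N - k) (S 1) \<noteq> 0"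
      using E(5)[OF o(1)] E(5)[OF o(2)] hk by simp_all
    have sums: "hypocycloid_sum n k (N - k) (band n Q {k, N - k})"
      "hypocycloid_sum n k (N - k) (band n (S 1) {k, N - k})"
      using hypocycloid_sum_band[OF Q o hk] hypocycloid_sum_band[OF Q1 o hk1] by simp_all
    have "tends_in_shape_to (\<lambda>t. S (2 * t)) (band n Q {k, N - k})"
      "tends_in_shape_to (\<lambda>t. S (2 * t + 1)) (band n (S 1) {k, N - k})"
      using shape[of k "{k, N - k}" k] k(1) kN hk(1) zero by simp_all
    with k sums show ?thesis unfolding N_def by blast
  qed
  show "\<exists>m L0 L1. m \<noteq> n div 2 - 1 \<and>
      discrete_hypocycloid n m L0 \<and> discrete_hypocycloid n m L1 \<and>
      tends_in_shape_to (\<lambda>k. S (2 * k)) L0 \<and> tends_in_shape_to (\<lambda>k. S (2 * k + 1)) L1"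
    if nr: "\<not> resonant n Q"
  proof (cases "\<exists>k. 2 \<le> k \<and> 2 * k \<le> N \<and> (harmonic n k Q \<noteq> 0 \<or> harmonic n (N - k) Q \<noteq> 0)")
    case True
    define P where "P k \<longleftrightarrow> 2 \<le> k \<and> 2 * k \<le> N \<and> (harmonic n k Q \<noteq> 0 \<or> harmonic n (N - k) Q \<noteq> 0)" for k
    define k where "k = (LEAST k. P k)"
    have "P k" unfolding k_def by (rule LeastI_ex) (use True in \<open>simp add: P_def\<close>)
    then have k: "2 \<le> k" "2 * k \<le> N" "harmonic n k Q \<noteq> 0 \<or> harmonic n (N - k) Q \<noteq> 0"
      by (auto simp: P_def)
    have zero: "harmonic n i Q = 0 \<and> harmonic n (N - i) Q = 0" if "2 \<le> i" "i < k" for i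
      using not_less_Least[of i P] that k(2) by (auto simp: P_def k_def)
    have "\<not> (4 * k < n \<and> harmonic n k Q \<noteq> 0 \<and> harmonic n (N - k) Q \<noteq> 0)"
    proof
      assume "4 * k < n \<and> harmonic n k Q \<noteq> 0 \<and> harmonic n (N - k) Q \<noteq> 0"
      then have "resonant n Q"
        unfolding resonant_def N_def[symmetric] using k(1) zero by (intro exI[of _ k]) simp
      with nr show False ..
    qed
    then obtain m where m: "m \<in> {k, N - k}" "harmonic n m Q \<noteq> 0"
      and rest: "\<And>i. i \<in> {k, N - k} - {m} \<Longrightarrow> harmonic n i Q = 0"
    proof -
      assume nb: "\<not> (4 * k < n \<and> harmonic n k Q \<noteq> 0 \<and> harmonic n (N - k) Q \<noteq> 0)"
      show thesis
      \<comment> \<open>At \<open>k = n/4\<close> the pair collapses to one order; otherwise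
        non-resonance leaves exactly one nonzero harmonic in it.\<close>
      proof (cases "N = 2 * k")
        case True
        then show ?thesis using k(3) that[of k] by auto
      next
        case False
        then have "4 * k < n" using k(2) nN by simp
        with nb k(3) show ?thesis using that[of k] that[of "N - k"] by auto
      qed
    qed
    have mo: "m \<in> orders n" and mN: "m \<noteq> N - 1" using m(1) k(1,2) by (auto simp: ord)
    have "harmonic n m (S 1) \<noteq> 0" using E(5)[OF mo] m(2) by simp
    then have "discrete_hypocycloid n m (band n Q {m})" "discrete_hypocycloid n m (band n (S 1) {m})"
      using discrete_hypocycloid_band[OF Q mo m(2)] discrete_hypocycloid_band[OF Q1 mo] by simp_all
    moreover have sub: "{m} \<subseteq> {k, N - k}" using m(1) by simp
    have "tends_in_shape_to (\<lambda>t. S (2 * t)) (band n Q {m})"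
      "tends_in_shape_to (\<lambda>t. S (2 * t + 1)) (band n (S 1) {m})"
      by (rule shape[OF k(1,2) sub zero rest singletonI m(2)]; assumption)+
    ultimately show ?thesis using mN unfolding N_def by blast
  next
    case False
    \<comment> \<open>Only order 1 survives in this case. Every iterate is then the centroid itself,
      a hypocycloid of order 1, and \<open>1 \<noteq> N - 1\<close> because
      \<open>N \<ge> 3\<close>. Orders above \<open>N/2\<close> are treated through their mirror
      images.\<close>
    have zero: "harmonic n k Q = 0" if k: "k \<in> orders n - {1}" for k
    proof (cases "k = N - 1 \<or> 2 * k \<le> N")
      case True
      then show ?thesis using False h k by (auto simp: ord N_def)
    next
      case F: False
      then have "2 \<le> N - k \<and> 2 * (N - k) \<le> N \<and> N - (N - k) = k" using k by (auto simp: ord)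
      then show ?thesis using False by metis
    qed
    have C: "vertex (S (2 * t)) j = vertex_centroid n Q" "vertex (S (2 * t + 1)) j = vertex_centroid n Q" for t j
      using vertex_iterate_constant[OF assms(2) S] zero by blast+
    have "tends_in_shape_to (\<lambda>k. S (2 * k)) (band n Q {1})"
      by (rule tends_to_constant(2)[where z = "vertex_centroid n Q"]) (rule C(1), rule vertex_band_1[OF Q])
    moreover have "tends_in_shape_to (\<lambda>k. S (2 * k + 1)) (band n (S 1) {1})"
      by (rule tends_to_constant(2)[where z = "vertex_centroid n Q"])
         (rule C(2), use vertex_band_1[OF Q1] E(3) in metis)
    moreover have "1 \<noteq> n div 2 - 1" using N3 N_def by simp
    ultimately show ?thesis
      using discrete_hypocycloid_band_1[OF Q] discrete_hypocycloid_band_1[OF Q1] by blast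
  qed
qed

lemma generic_empty: "generic_in {} {}"
  by (simp add: generic_in_def)

theorem theorem12:
  fixes n :: nat
  shows
    "(odd n \<longrightarrow>
       (\<forall>Q\<in>zero_perimeter_hedgehogs n. \<exists>!S. iterated_evolvents n Q S) \<and>
       (\<exists>G\<subseteq>zero_perimeter_hedgehogs n. generic_in (zero_perimeter_hedgehogs n) G \<and>
          (\<forall>Q\<in>G. \<forall>S. iterated_evolvents n Q S \<longrightarrow>
             (n > 3 \<longrightarrow> expands S) \<and>
             (\<exists>L0 L1.
                discrete_hypocycloid n ((n - 1) div 2) L0 \<and>
                discrete_hypocycloid n ((n - 1) div 2) L1 \<and>
                (n > 3 \<longrightarrow> \<not> homothetic L0 L1) \<and>
                tends_in_shape_to (\<lambda>k. S (2 * k)) L0 \<and>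
                tends_in_shape_to (\<lambda>k. S (2 * k + 1)) L1)))) \<and>
     (even n \<longrightarrow>
       (\<forall>Q\<in>balanced_hedgehogs n. \<exists>!S. iterated_evolvents n Q S) \<and>
       (\<exists>G\<subseteq>balanced_hedgehogs n. generic_in (balanced_hedgehogs n) G \<and>
          (\<forall>Q\<in>G. \<forall>S. iterated_evolvents n Q S \<longrightarrow>
             (\<exists>L0 L1.
                discrete_hypocycloid n (n div 2 - 1) L0 \<and>
                discrete_hypocycloid n (n div 2 - 1) L1 \<and>
                (n > 4 \<longrightarrow> \<not> homothetic L0 L1) \<and>
                tends_to (\<lambda>k. S (2 * k)) L0 \<and>
                tends_to (\<lambda>k. S (2 * k + 1)) L1)) \<and>
          (\<forall>Q\<in>balanced_hedgehogs n - G. \<forall>S. iterated_evolvents n Q S \<longrightarrow>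
             shrinks_to S (vertex_centroid n Q) \<and>
             (\<not> resonant n Q \<longrightarrow>
                (\<exists>m L0 L1.
                   m \<noteq> n div 2 - 1 \<and>
                   discrete_hypocycloid n m L0 \<and>
                   discrete_hypocycloid n m L1 \<and>
                   tends_in_shape_to (\<lambda>k. S (2 * k)) L0 \<and>
                   tends_in_shape_to (\<lambda>k. S (2 * k + 1)) L1)) \<and>
             (resonant n Q \<longrightarrow>
                (\<exists>m L0 L1.
                   2 \<le> m \<and> 4 * m < n \<and>
                   hypocycloid_sum n m (n div 2 - m) L0 \<and>
                   hypocycloid_sum n m (n div 2 - m) L1 \<and>
                   tends_in_shape_to (\<lambda>k. S (2 * k)) L0 \<and>
                   tends_in_shape_to (\<lambda>k. S (2 * k + 1)) L1)))))"
  (is "(_ \<longrightarrow> ?A) \<and> (_ \<longrightarrow> ?B)")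
proof -
  let ?X = "{Q. centered n Q}"
  have large: "3 \<le> n" if "centered n Q" for Q
    using that equiangular_hedgehogD(1) by (auto simp: centered_def)
  have generic: "generic_in ?X {Q. centered n Q \<and> harmonic n m Q \<noteq> 0}" if "3 \<le> n \<Longrightarrow> m \<in> orders n" for m
  proof (cases "3 \<le> n")
    case True
    then show ?thesis using generic_harmonic_nonzero that by blast
  next
    case False
    \<comment> \<open>There are no equiangular hedgehogs with fewer than three sides.\<close>
    then have "?X = {}" "{Q. centered n Q \<and> harmonic n m Q \<noteq> 0} = {}" using large by blast+
    then show ?thesis by (simp only: generic_empty)
  qed
  have ?A if "odd n"
  proof -
    let ?m = "(n - 1) div 2"
    let ?G = "{Q. centered n Q \<and> harmonic n ?m Q \<noteq> 0}"
    have "generic_in ?X ?G"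
      by (rule generic) (use that in \<open>auto simp: orders_def elim!: oddE\<close>)
    moreover have "?G \<subseteq> ?X" by blast
    ultimately show ?thesis
      unfolding zero_perimeter_hedgehogs_eq[OF that]
      using iterated_evolvents_unique odd_case[OF that _ refl]
      by (intro conjI ballI exI[of _ ?G]) blast+
  qed
  moreover have ?B if "even n"
  proof -
    let ?m = "n div 2 - 1"
    \<comment> \<open>For \<open>n = 4\<close> the order \<open>n/2 - 1\<close> is 1 and every
      balanced hedgehog is a point, so no limit of another order could exist; all hedgehogs are
      therefore put into \<open>G\<close>.\<close>
    let ?G = "{Q. centered n Q \<and> (n \<le> 4 \<or> harmonic n ?m Q \<noteq> 0)}"
    have "generic_in ?X ?G"
    proof (cases "n \<le> 4")
      case True
      then have "?G = ?X" by blast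
      moreover have "?X \<subseteq> closure ?X" by (rule closure_subset)
      ultimately show ?thesis by (simp add: generic_in_def)
    next
      case False
      then have "?G = {Q. centered n Q \<and> harmonic n ?m Q \<noteq> 0}" by simp
      moreover have "generic_in ?X {Q. centered n Q \<and> harmonic n ?m Q \<noteq> 0}"
        by (rule generic) (use that False in \<open>auto simp: orders_def elim!: evenE\<close>)
      ultimately show ?thesis by (simp only:)
    qed
    note gen = this
    have deg: "centered n Q" "n > 4" "harmonic n ?m Q = 0" if "Q \<in> ?X - ?G" for Q
      using that by auto
    show ?thesis
      unfolding balanced_hedgehogs_eq[OF that]
    proof (intro conjI ballI exI[of _ ?G] allI impI, goal_cases)
      case (1 Q)
      then show ?case using iterated_evolvents_unique by blast
    next
      case 2
      then show ?case by blast
    next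
      case 3
      then show ?case by (rule gen)
    next
      case (4 Q S)
      then show ?case by (intro even_generic_case[OF that _ refl, of Q]) simp_all
    next
      case (5 Q S)
      then show ?case using even_degenerate_case(1)[OF that deg[OF 5(1)]] by blast
    next
      case (6 Q S)
      then show ?case by (intro even_degenerate_case(2)[OF that deg[OF 6(1)]])
    next
      case (7 Q S)
      then show ?case by (intro even_degenerate_case(3)[OF that deg[OF 7(1)]])
    qed
  qed
  ultimately show ?thesis by blast
qed

end
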